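(* Let $C^\circ$ be a symmetric cone in a Euclidean Jordan algebra $(X,\bullet)$ with unit $e$, i.e. $C^\circ$ is the interior of the cone of squares $C=\{x^2\colon x\in X\}$, and take the unit $e\in C^\circ$ as the base point to construct the horofunction boundaries. Then the following assertions hold: (i) $\mathcal{H}_F$ consists of those $f\in\mathcal{C}(C^\circ)$ for which there exists $z\in\partial C$ with $\|z\|_e=1$ such that $f(x)=\mathrm{RFunk}_C(x^{-1},z)$ for all $x\in C^\circ$. (ii) $\mathcal{H}_R$ consists of those $g\in\mathcal{C}(C^\circ)$ for which there exists $y\in\partial C$ with $\|y\|_e=1$ such that $g(x)=\mathrm{RFunk}_C(x,y)$ for all $x\in C^\circ$. (iii) $\mathcal{H}_H$ consists of those $h\in\mathcal{C}(C^\circ)$ for which there exist $y,z\in\partial C$ with $\|y\|_e=\|z\|_e=1$ and $y\bullet z=0$ such that $$h(x)=\mathrm{RFunk}_C(x^{-1},z)+\mathrm{RFunk}_C(x,y)\quad\text{for all }x\in C^\circ.$$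
   Context: A Euclidean Jordan algebra $(X,\bullet)$ is a finite dimensional real inner product space $(X,\langle\cdot,\cdot\rangle)$ with a bilinear product $\bullet$ and unit element $e$ such that for all $x,y,w,z\in X$: $x\bullet y=y\bullet x$; $x\bullet(x^2\bullet y)=x^2\bullet(x\bullet y)$; and $\langle x\bullet w,z\rangle=\langle w,x\bullet z\rangle$. Here $x^2=x\bullet x$, and $x^{-1}$ is the Jordan algebra inverse of $x\in C^\circ$ (the inverse of $x$ in the associative subalgebra generated by $x$ and $e$). The squares form a closed cone $C$; $x\le_C y$ means $y-x\in C$; and $\|x\|_e=\inf\{\lambda\ge0\colon -\lambda e\le_C x\le_C\lambda e\}$. For $x\in X$ and $y\in C^\circ$ let $M(x/y)=\inf\{\beta\in\mathbb{R}\colon x\le_C\beta y\}$. For $x,y\in C^\circ$ put $\mathrm{Funk}_C(x,y)=\log M(x/y)$, $\mathrm{RFunk}_C(x,y)=\log M(y/x)$ and $\delta_C(x,y)=\mathrm{Funk}_C(x,y)+\mathrm{RFunk}_C(x,y)$ (Hilbert's metric); the formula $\mathrm{RFunk}_C(x,y)=\log M(y/x)$ is also used for $x\in C^\circ$, $y\in C\setminus\{0\}$. Thompson's metric on $C^\circ$ is $d_C(x,y)=\log\max\{M(x/y),M(y/x)\}$. $\mathcal{C}(C^\circ)$ is the space of continuous functions $(C^\circ,d_C)\to\mathbb{R}$ with the topology of uniform convergence on compact sets. With base point $e$ and $\rho\in\{\mathrm{Funk}_C,\mathrm{RFunk}_C,\delta_C\}$, define $i_\rho\colon C^\circ\to\mathcal{C}(C^\circ)$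 by $i_\rho(y)(x)=\rho(x,y)-\rho(e,y)$. The horofunction boundary is $\overline{i_\rho(C^\circ)}\setminus i_\rho(C^\circ)$ (closure in $\mathcal{C}(C^\circ)$), denoted $\mathcal{H}_F$, $\mathcal{H}_R$, $\mathcal{H}_H$ for $\rho=\mathrm{Funk}_C$, $\mathrm{RFunk}_C$, $\delta_C$ respectively. *)

theory Defs
  imports "HOL-Analysis.Analysis"
begin

locale euclidean_jordan_algebra =
  fixes jprod :: "'a::euclidean_space \<Rightarrow> 'a \<Rightarrow> 'a" (infixl "\<odot>" 70)
    and e :: 'a
  assumes jprod_bilinear: "bilinear (\<odot>)"
    and jprod_unit: "e \<odot> x = x"
    and jprod_commute: "x \<odot> y = y \<odot> x"
    and jprod_jordan: "x \<odot> ((x \<odot> x) \<odot> y) = (x \<odot> x) \<odot> (x \<odot> y)"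
    and jprod_self_adjoint: "(x \<odot> w) \<bullet> z = w \<bullet> (x \<odot> z)"

definition square_cone :: "('a::euclidean_space \<Rightarrow> 'a \<Rightarrow> 'a) \<Rightarrow> 'a set" where
  "square_cone jprod = range (\<lambda>x. jprod x x)"

definition generated_subalgebra ::
    "('a::euclidean_space \<Rightarrow> 'a \<Rightarrow> 'a) \<Rightarrow> 'a set \<Rightarrow> 'a set" where
  "generated_subalgebra jprod A =
     (\<lambda>S. subspace S \<and> (\<forall>u\<in>S. \<forall>v\<in>S. jprod u v \<in> S)) hull A"

text \<open>The inverse is sought inside the (associative) subalgebra generated by \<open>x\<close> and \<open>e\<close>:
  in the whole algebra the equation \<open>jprod x y = e\<close> may have several solutions \<open>y\<close>.\<close>

definition jordan_inverse :: "('a::euclidean_space \<Rightarrow> 'a \<Rightarrow> 'a) \<Rightarrow> 'a \<Rightarrow> 'a \<Rightarrow> 'a" where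
  "jordan_inverse jprod e x =
     (THE y. y \<in> generated_subalgebra jprod {x, e} \<and> jprod x y = e)"

definition cone_le :: "'a::euclidean_space set \<Rightarrow> 'a \<Rightarrow> 'a \<Rightarrow> bool" where
  "cone_le C x y \<longleftrightarrow> y - x \<in> C"

definition order_unit_norm :: "'a::euclidean_space set \<Rightarrow> 'a \<Rightarrow> 'a \<Rightarrow> real" where
  "order_unit_norm C e x =
     Inf {l. 0 \<le> l \<and> cone_le C (- (l *\<^sub>R e)) x \<and> cone_le C x (l *\<^sub>R e)}"

text \<open>\<open>cone_M C x y\<close> is $M(x/y)$; it is meaningful only for \<open>y \<in> interior C\<close>.\<close>

definition cone_M :: "'a::euclidean_space set \<Rightarrow> 'a \<Rightarrow> 'a \<Rightarrow> real" where
  "cone_M C x y = Inf {\<beta>. cone_le C x (\<beta> *\<^sub>R y)}"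

definition funk :: "'a::euclidean_space set \<Rightarrow> 'a \<Rightarrow> 'a \<Rightarrow> real" where
  "funk C x y = ln (cone_M C x y)"

definition rfunk :: "'a::euclidean_space set \<Rightarrow> 'a \<Rightarrow> 'a \<Rightarrow> real" where
  "rfunk C x y = ln (cone_M C y x)"

definition hilbert_dist :: "'a::euclidean_space set \<Rightarrow> 'a \<Rightarrow> 'a \<Rightarrow> real" where
  "hilbert_dist C x y = funk C x y + rfunk C x y"

text \<open>Thompson's metric lives on \<open>interior C\<close>. It is set to \<open>0\<close> elsewhere because the locale
  \<open>Metric_space\<close> requires nonnegativity and symmetry of the distance on the whole type.\<close>

definition thompson_dist :: "'a::euclidean_space set \<Rightarrow> 'a \<Rightarrow> 'a \<Rightarrow> real" where
  "thompson_dist C x y =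
     (if x \<in> interior C \<and> y \<in> interior C then ln (max (cone_M C x y) (cone_M C y x)) else 0)"

definition thompson_topology :: "'a::euclidean_space set \<Rightarrow> 'a topology" where
  "thompson_topology C = Metric_space.mtopology (interior C) (thompson_dist C)"

text \<open>A function defined on \<open>topspace T\<close> only is represented by an extensional function,
  so that equality of functions is equality on \<open>topspace T\<close>.\<close>

definition cont_funs :: "'a topology \<Rightarrow> ('a \<Rightarrow> real) set" where
  "cont_funs T = {f \<in> extensional (topspace T). continuous_map T euclideanreal f}"

definition compact_unif_topology :: "'a topology \<Rightarrow> ('a \<Rightarrow> real) topology" where
  "compact_unif_topology T = topology (\<lambda>U. U \<subseteq> cont_funs T \<and>
     (\<forall>f\<in>U. \<exists>K \<epsilon>. compactin T K \<and> 0 < \<epsilon> \<and>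
        {g \<in> cont_funs T. \<forall>x\<in>K. \<bar>g x - f x\<bar> < \<epsilon>} \<subseteq> U))"

lemma openin_compact_unif_topology:
  "openin (compact_unif_topology T) U \<longleftrightarrow> U \<subseteq> cont_funs T \<and>
     (\<forall>f\<in>U. \<exists>K \<epsilon>. compactin T K \<and> 0 < \<epsilon> \<and>
        {g \<in> cont_funs T. \<forall>x\<in>K. \<bar>g x - f x\<bar> < \<epsilon>} \<subseteq> U)"
proof -
  define N where "N K \<epsilon> f = {g \<in> cont_funs T. \<forall>x\<in>K. \<bar>g x - f x\<bar> < \<epsilon>}"
    for K and \<epsilon> :: real and f
  define P where "P U \<longleftrightarrow> U \<subseteq> cont_funs T \<and>
     (\<forall>f\<in>U. \<exists>K \<epsilon>. compactin T K \<and> 0 < \<epsilon> \<and> N K \<epsilon> f \<subseteq> U)" for U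
  have "istopology P"
    unfolding istopology_def
  proof (intro conjI allI impI)
    fix U V assume U: "P U" and V: "P V"
    show "P (U \<inter> V)"
      unfolding P_def
    proof (intro conjI ballI)
      show "U \<inter> V \<subseteq> cont_funs T" using U by (auto simp: P_def)
      fix f assume f: "f \<in> U \<inter> V"
      obtain K1 e1 where 1: "compactin T K1" "0 < e1" "N K1 e1 f \<subseteq> U"
        using U f unfolding P_def by blast
      obtain K2 e2 where 2: "compactin T K2" "0 < e2" "N K2 e2 f \<subseteq> V"
        using V f unfolding P_def by blast
      have "N (K1 \<union> K2) (min e1 e2) f \<subseteq> N K1 e1 f \<inter> N K2 e2 f"
        by (auto simp: N_def)
      then show "\<exists>K \<epsilon>. compactin T K \<and> 0 < \<epsilon> \<and> N K \<epsilon> f \<subseteq> U \<inter> V"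
        using 1 2 compactin_Un[OF 1(1) 2(1)]
        by (intro exI[of _ "K1 \<union> K2"] exI[of _ "min e1 e2"]) auto
    qed
  next
    fix \<K> assume "\<forall>U\<in>\<K>. P U"
    then show "P (\<Union>\<K>)"
      unfolding P_def by (meson Sup_least Union_upper Union_iff subset_trans)
  qed
  moreover have "compact_unif_topology T = topology P"
    by (simp add: compact_unif_topology_def P_def [abs_def] N_def)
  ultimately show ?thesis
    by (simp add: topology_inverse' P_def N_def)
qed

lemma topspace_compact_unif_topology [simp]:
  "topspace (compact_unif_topology T) = cont_funs T"
proof (rule antisym)
  show "topspace (compact_unif_topology T) \<subseteq> cont_funs T"
    using openin_topspace openin_compact_unif_topology by blast
  have "openin (compact_unif_topology T) (cont_funs T)"
    unfolding openin_compact_unif_topology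
    by (auto intro!: exI[of _ "{}"] exI[of _ "1::real"])
  then show "cont_funs T \<subseteq> topspace (compact_unif_topology T)"
    by (rule openin_subset)
qed

definition horo_map ::
    "'a::euclidean_space set \<Rightarrow> 'a \<Rightarrow> ('a \<Rightarrow> 'a \<Rightarrow> real) \<Rightarrow> 'a \<Rightarrow> 'a \<Rightarrow> real" where
  "horo_map C b \<rho> y = (\<lambda>x\<in>interior C. \<rho> x y - \<rho> b y)"

definition horofunction_boundary ::
    "'a::euclidean_space set \<Rightarrow> 'a \<Rightarrow> ('a \<Rightarrow> 'a \<Rightarrow> real) \<Rightarrow> ('a \<Rightarrow> real) set" where
  "horofunction_boundary C b \<rho> =
     (compact_unif_topology (thompson_topology C)) closure_of (horo_map C b \<rho> ` interior C)
       - horo_map C b \<rho> ` interior C"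

end

theory Submission
  imports Defs
begin

text \<open>The cone of squares \<open>C\<close> is closed, convex and satisfies \<open>\<langle>u, v\<rangle> \<ge> 0\<close> for \<open>u, v \<in> C\<close>. For
  every such cone \<open>M(y/x) \<le> b\<close> is equivalent to \<open>b x - y \<in> C\<close> and \<open>M(y/x) < b\<close> to
  \<open>b x - y \<in> interior C\<close>; hence \<open>M\<close> is jointly continuous for \<open>x\<close> in the interior, and Thompson's
  metric induces the Euclidean topology. The elements \<open>y \<in> C\<close> with \<open>M(y/e) = 1\<close> form a compact
  set, the unit slice, on which \<open>M(y/e)\<close> is the order unit norm.

  The normalised function \<open>x \<mapsto> RFunk(x,y) - RFunk(e,y)\<close> depends only on the projection of \<open>y\<close> to
  the slice, and equals \<open>x \<mapsto> log M(y/x)\<close> for \<open>y\<close> in the slice. That formula makes sense on the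
  whole compact slice and depends continuously on \<open>y\<close>, so its image is the closure; since
  \<open>y \<mapsto> M(y/\<cdot>)\<close> is injective, exactly the frontier points of the slice give new functions. This is
  \<open>horofunction_boundary_rfunk\<close>, an instance of \<open>horofunction_boundary_parametrization\<close>.

  The Jordan structure enters through the identity \<open>M(x/y) = M(y\<^sup>-\<^sup>1/x\<^sup>-\<^sup>1)\<close>
  (\<open>cone_M_jordan_inverse\<close>), which turns the Funk case into the reverse Funk case and makes inversion
  continuous. It says that inversion reverses the order (\<open>jordan_inverse_antitone\<close>). To
  prove this one moves \<open>x\<close> to \<open>e\<close> by an automorphism of the cone, and for \<open>x = e\<close> the claim can be read
  off the spectral decomposition of \<open>y\<close>. The automorphisms are the flows \<open>T\<^sub>t\<close> of the self-adjoint
  maps \<open>u \<mapsto> a \<odot> u\<close>. With the quadratic representation \<open>P(u) v = 2 u \<odot> (u \<odot> v) - u\<^sup>2 \<odot> v\<close>, a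
  Jordan identity of degree four (\<open>quad_rep_derivation\<close>) integrates to
  \<open>P(T\<^sub>t y) T\<^sub>-\<^sub>t = T\<^sub>t P(y)\<close>. As \<open>P\<close> is injective at interior points of \<open>C\<close> and singular at frontier
  points, the path \<open>t \<mapsto> T\<^sub>t y\<close> cannot leave the interior; as \<open>P(y) y\<^sup>-\<^sup>1 = y\<close>, the same formula gives
  \<open>(T y)\<^sup>-\<^sup>1 = T\<^sup>-\<^sup>1 y\<^sup>-\<^sup>1\<close>.

  For Hilbert's metric the parameter is the pair of the projections of \<open>y\<close> and of \<open>y\<^sup>-\<^sup>1\<close> to the slice.
  Passing to the limit in \<open>y \<odot> y\<^sup>-\<^sup>1 = e\<close> shows that a new limit \<open>(y, z)\<close> of such pairs consists of
  frontier points with \<open>y \<odot> z = 0\<close> (\<open>opposite_pairs_limit_frontier\<close>). Conversely the positive parts of the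
  spectral decompositions of such \<open>y\<close> and \<open>z\<close> are orthogonal to each other, which yields an explicit curve
  \<open>x\<^sub>t \<ge> y\<close> with \<open>x\<^sub>t \<rightarrow> y\<close>, \<open>t\<^sup>2 x\<^sub>t\<^sup>-\<^sup>1 \<ge> z\<close> and \<open>t\<^sup>2 x\<^sub>t\<^sup>-\<^sup>1 \<rightarrow> z\<close> (\<open>complementary_curve\<close>). So \<open>(y, z)\<close> is a
  limit, and along the curve the limit function tends to \<open>-\<infinity>\<close>, whereas each normalised distance
  function is bounded below; hence it is new.\<close>

section \<open>Self-adjoint operators and their flows\<close>

text \<open>A positive semidefinite self-adjoint map annihilates the null vectors of its quadratic form.\<close>

lemma psd_kernel:
  fixes g :: "'a::real_inner \<Rightarrow> 'a"
  assumes lin: "linear g" and sa: "\<And>x y. g x \<bullet> y = x \<bullet> g y"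
    and S: "subspace S" "\<And>x. x \<in> S \<Longrightarrow> g x \<in> S"
    and psd: "\<And>w. w \<in> S \<Longrightarrow> 0 \<le> g w \<bullet> w"
    and v: "v \<in> S" "g v \<bullet> v = 0"
  shows "g v = 0"
proof -
  define b where "b = g v \<bullet> g v"
  define c where "c = g (g v) \<bullet> g v"
  have c0: "c \<ge> 0" unfolding c_def using psd S v by blast
  \<comment> \<open>Positivity at \<open>v + t g(v)\<close> reads \<open>2 t b + t\<^sup>2 c \<ge> 0\<close>, which a small negative \<open>t\<close> violates
    unless \<open>b = 0\<close>.\<close>
  define t where "t = - b / (c + 1)"
  have "v + t *\<^sub>R g v \<in> S" using S v by (simp add: subspace_add subspace_mul)
  from psd[OF this] have "0 \<le> g (v + t *\<^sub>R g v) \<bullet> (v + t *\<^sub>R g v)" .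
  also have "\<dots> = 2 * t * b + t^2 * c"
    using v(2) sa[of "g v" v]
    by (simp add: linear_add[OF lin] linear_scale[OF lin] inner_add inner_commute b_def c_def
        power2_eq_square algebra_simps)
  also have "\<dots> = - (t^2 * (c + 2))"
  proof -
    have b: "b = - (t * (c + 1))" using c0 by (simp add: t_def)
    show ?thesis unfolding b by (simp add: algebra_simps power2_eq_square)
  qed
  finally have "t = 0" using c0 by (simp add: mult_le_0_iff)
  then have "b = 0" using c0 by (simp add: t_def)
  then show ?thesis by (simp add: b_def)
qed

text \<open>The eigenvector is a maximum point of the Rayleigh quotient on an invariant subspace; the
  last conclusion records the maximality of its eigenvalue.\<close>

lemma selfadjoint_top_eigenvector:
  fixes f :: "'a::euclidean_space \<Rightarrow> 'a"
  assumes lin: "linear f" and sa: "\<And>x y. f x \<bullet> y = x \<bullet> f y"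
    and S: "subspace S" "\<And>x. x \<in> S \<Longrightarrow> f x \<in> S" "S \<noteq> {0}"
  obtains v l where "v \<in> S" "norm v = 1" "f v = l *\<^sub>R v"
    "\<And>w. w \<in> S \<Longrightarrow> f w \<bullet> w \<le> l * (w \<bullet> w)"
proof -
  let ?K = "S \<inter> sphere 0 1"
  have "compact ?K" using S(1) by (simp add: closed_Int_compact closed_subspace)
  moreover have "?K \<noteq> {}"
  proof -
    obtain w where "w \<in> S" "w \<noteq> 0" using S(1,3) subspace_0 by blast
    then have "(1 / norm w) *\<^sub>R w \<in> ?K" using S(1) by (simp add: subspace_mul)
    then show ?thesis by blast
  qed
  moreover have "continuous_on ?K (\<lambda>v. f v \<bullet> v)"
    by (intro continuous_intros linear_continuous_on linear_conv_bounded_linear[THEN iffD1] lin)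
  ultimately obtain v where v: "v \<in> ?K" and max: "\<And>w. w \<in> ?K \<Longrightarrow> f w \<bullet> w \<le> f v \<bullet> v"
    using continuous_attains_sup[of ?K "\<lambda>v. f v \<bullet> v"] by blast
  define l where "l = f v \<bullet> v"
  have ray: "f w \<bullet> w \<le> l * (w \<bullet> w)" if "w \<in> S" for w
  proof (cases "w = 0")
    case False
    have "(1 / norm w) *\<^sub>R w \<in> ?K" using that False S(1) by (simp add: subspace_mul)
    from max[OF this] have "(f w \<bullet> w) / (norm w)^2 \<le> l"
      by (simp add: linear_scale[OF lin] l_def power2_eq_square)
    then show ?thesis using False by (simp add: field_simps dot_square_norm)
  qed simp
  have "l *\<^sub>R v - f v = 0"
  proof (rule psd_kernel[where g = "\<lambda>w. l *\<^sub>R w - f w" and S = S])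
    show "linear (\<lambda>w. l *\<^sub>R w - f w)"
      by (intro linear_compose_sub lin linear_scale_self)
    show "(l *\<^sub>R v - f v) \<bullet> v = 0" using v by (simp add: inner_diff l_def dot_square_norm)
  qed (use S v ray sa in \<open>auto simp: inner_diff subspace_diff subspace_mul\<close>)
  with v ray show ?thesis by (intro that[of v l]) auto
qed

lemma selfadjoint_eigenbasis:
  fixes f :: "'a::euclidean_space \<Rightarrow> 'a"
  assumes lin: "linear f" and sa: "\<And>x y. f x \<bullet> y = x \<bullet> f y"
    and "subspace S" "\<And>x. x \<in> S \<Longrightarrow> f x \<in> S"
  shows "\<exists>B. finite B \<and> B \<subseteq> S \<and> pairwise orthogonal B \<and> (\<forall>b\<in>B. norm b = 1 \<and> (\<exists>l. f b = l *\<^sub>R b))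
    \<and> span B = S"
  using assms(3,4)
proof (induction "dim S" arbitrary: S rule: less_induct)
  case less
  show ?case
  proof (cases "S = {0}")
    case True
    then show ?thesis by (intro exI[of _ "{}"]) auto
  next
    case False
    obtain v l where v: "v \<in> S" "norm v = 1" "f v = l *\<^sub>R v"
      using selfadjoint_top_eigenvector[OF lin sa less.prems False] by metis
    define S' where "S' = {w \<in> S. v \<bullet> w = 0}"
    have S': "subspace S'" "S' \<subseteq> S"
      using less.prems(1) by (auto simp: S'_def subspace_def inner_add)
    have "v \<notin> S'" using v by (auto simp: S'_def)
    then have "dim S' < dim S"
      using v S' less.prems(1) by (metis dim_subset le_neq_implies_less subspace_dim_equal order_refl)
    moreover have "f w \<in> S'" if "w \<in> S'" for w
      using that less.prems sa[of v w] v by (auto simp: S'_def)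
    ultimately obtain B where B: "finite B" "B \<subseteq> S'" "pairwise orthogonal B"
      "\<forall>b\<in>B. norm b = 1 \<and> (\<exists>l. f b = l *\<^sub>R b)" "span B = S'"
      using less.hyps S'(1) by metis
    have "S \<subseteq> span (insert v B)"
    proof
      fix w assume "w \<in> S"
      then have "w - (v \<bullet> w) *\<^sub>R v \<in> span B"
        using v less.prems(1) B(5)
        by (auto simp: S'_def inner_diff subspace_diff subspace_mul dot_square_norm)
      then show "w \<in> span (insert v B)" by (auto simp: span_insert)
    qed
    moreover have "span (insert v B) \<subseteq> S"
      using v B(2) S'(2) less.prems(1) by (intro span_minimal) auto
    ultimately show ?thesis
      using B v S' by (intro exI[of _ "insert v B"])
        (auto simp: pairwise_insert S'_def orthogonal_def inner_commute)
  qed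
qed

text \<open>The flow \<open>T\<close> of the linear equation \<open>u' = f u\<close>, that is, the exponential of \<open>t f\<close>, written in an
  orthonormal eigenbasis of \<open>f\<close>. The last conclusion is uniqueness of solutions.\<close>

lemma selfadjoint_flow:
  fixes f :: "'a::euclidean_space \<Rightarrow> 'a"
  assumes lin: "linear f" and sa: "\<And>x y. f x \<bullet> y = x \<bullet> f y"
  obtains T :: "real \<Rightarrow> 'a \<Rightarrow> 'a" where
    "\<And>t. linear (T t)" "\<And>y. T 0 y = y"
    "\<And>y t. ((\<lambda>t. T t y) has_vector_derivative f (T t y)) (at t)"
    "\<And>Q t. (\<And>s. (Q has_vector_derivative f (Q s)) (at s)) \<Longrightarrow> Q t = T t (Q 0)"
proof -
  obtain B where B: "finite B" "pairwise orthogonal B"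
    "\<And>b. b \<in> B \<Longrightarrow> norm b = 1" "\<And>b. b \<in> B \<Longrightarrow> (\<exists>l. f b = l *\<^sub>R b)" "span B = UNIV"
    using selfadjoint_eigenbasis[OF lin sa, of UNIV] by auto
  then obtain l where l: "\<And>b. b \<in> B \<Longrightarrow> f b = l b *\<^sub>R b" by metis
  have expand: "(\<Sum>b\<in>B. (y \<bullet> b) *\<^sub>R b) = y" for y
    using orthonormal_basis_expand[OF B(2) B(3)] B(1,5) by simp
  define T where "T t y = (\<Sum>b\<in>B. (exp (l b * t) * (y \<bullet> b)) *\<^sub>R b)" for t y
  have fT: "f (T t y) = (\<Sum>b\<in>B. (l b * (exp (l b * t) * (y \<bullet> b))) *\<^sub>R b)" for t y
    by (simp add: T_def linear_sum[OF lin] linear_scale[OF lin] l mult_ac)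
  show ?thesis
  proof
    show "linear (T t)" for t
      by (rule linearI)
        (simp_all add: T_def inner_add algebra_simps sum.distrib scaleR_sum_right)
    show "T 0 y = y" for y by (simp add: T_def expand)
    show "((\<lambda>t. T t y) has_vector_derivative f (T t y)) (at t)" for y t
      unfolding fT unfolding T_def
      by (auto intro!: derivative_eq_intros simp: mult_ac)
    fix Q t assume Q: "\<And>s. (Q has_vector_derivative f (Q s)) (at s)"
    have coord: "Q t \<bullet> b = exp (l b * t) * (Q 0 \<bullet> b)" if b: "b \<in> B" for b
    proof -
      define h where "h s = exp (- (l b * s)) * (Q s \<bullet> b)" for s
      have Qb: "((\<lambda>s. Q s \<bullet> b) has_real_derivative l b * (Q s \<bullet> b)) (at s)" for s
      proof -
        have "((\<lambda>s. Q s \<bullet> b) has_vector_derivative f (Q s) \<bullet> b) (at s)"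
          by (rule bounded_linear.has_vector_derivative[OF bounded_linear_inner_left Q])
        also have "f (Q s) \<bullet> b = l b * (Q s \<bullet> b)" by (simp add: sa l b)
        finally show ?thesis by (simp add: has_real_derivative_iff_has_vector_derivative)
      qed
      have "(h has_real_derivative 0) (at s)" for s
        unfolding h_def by (auto intro!: derivative_eq_intros Qb)
      then have "h t = h 0" using DERIV_isconst_all by blast
      then show ?thesis by (simp add: h_def exp_minus field_simps)
    qed
    have "Q t = (\<Sum>b\<in>B. (Q t \<bullet> b) *\<^sub>R b)" by (simp add: expand)
    also have "\<dots> = T t (Q 0)" unfolding T_def by (intro sum.cong refl) (simp add: coord)
    finally show "Q t = T t (Q 0)" .
  qed
qed

section \<open>Identities in Jordan algebras\<close>

context euclidean_jordan_algebra
begin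

lemmas jprod_bilin_simps =
  bilinear_ladd[OF jprod_bilinear] bilinear_radd[OF jprod_bilinear]
  bilinear_lsub[OF jprod_bilinear] bilinear_rsub[OF jprod_bilinear]
  bilinear_lneg[OF jprod_bilinear] bilinear_rneg[OF jprod_bilinear]
  bilinear_lmul[OF jprod_bilinear] bilinear_rmul[OF jprod_bilinear]
  bilinear_lzero[OF jprod_bilinear] bilinear_rzero[OF jprod_bilinear]

lemma linear_jprod_left: "linear ((\<odot>) a)"
  using jprod_bilinear by (simp add: bilinear_def)

lemma bounded_bilinear_jprod: "bounded_bilinear (\<odot>)"
  using jprod_bilinear bilinear_conv_bounded_bilinear by blast

lemma jprod_unit_right: "x \<odot> e = x"
  by (metis jprod_commute jprod_unit)

lemma e_nonzero: "e \<noteq> 0"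
proof
  assume "e = 0"
  then have "x = 0" for x :: 'a using jprod_unit[of x] by (simp add: jprod_bilin_simps)
  then show False using nonempty_Basis nonzero_Basis by blast
qed

lemma inner_jprod_e: "(x \<odot> y) \<bullet> e = x \<bullet> y"
  using jprod_self_adjoint[of x y e] by (simp add: jprod_unit_right inner_commute)

lemma square_nonzero: "x \<noteq> 0 \<Longrightarrow> x \<odot> x \<noteq> 0"
  using inner_jprod_e[of x x] by auto

text \<open>The part of the Jordan identity at \<open>x + z\<close> that is linear in \<open>z\<close>. The identity at
  \<open>x + z\<close> and at \<open>x - z\<close> separates the linear from the quadratic part.\<close>

lemma jordan_linearized1:
  "z \<odot> ((x \<odot> x) \<odot> w) + 2 *\<^sub>R (x \<odot> ((x \<odot> z) \<odot> w)) =
   (x \<odot> x) \<odot> (z \<odot> w) + 2 *\<^sub>R ((x \<odot> z) \<odot> (x \<odot> w))"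
proof -
  define d where "d x z = z \<odot> ((x \<odot> x) \<odot> w) + 2 *\<^sub>R (x \<odot> ((x \<odot> z) \<odot> w))
     - (x \<odot> x) \<odot> (z \<odot> w) - 2 *\<^sub>R ((x \<odot> z) \<odot> (x \<odot> w))" for x z
  have sq: "(x + z) \<odot> (x + z) = x \<odot> x + 2 *\<^sub>R (x \<odot> z) + z \<odot> z" for x z
    by (simp add: jprod_bilin_simps jprod_commute[of z x] scaleR_2)
  have expand: "d x z + d z x = 0" for z
    using jprod_jordan[of "x + z" w] jprod_jordan[of x w] jprod_jordan[of z w]
    unfolding sq d_def by (simp add: jprod_bilin_simps jprod_commute[of z x] algebra_simps)
  have neg: "d x (- z) = - d x z" "d (- z) x = d z x" for z
    by (simp_all add: d_def jprod_bilin_simps algebra_simps)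
  have "2 *\<^sub>R d x z = (d x z + d z x) - (d x (- z) + d (- z) x)"
    unfolding neg by (simp add: scaleR_2)
  then have "d x z = 0" unfolding expand by simp
  then show ?thesis by (simp add: d_def algebra_simps)
qed

text \<open>The full polarisation of the Jordan identity.\<close>

lemma jordan_linearized2:
  "x \<odot> ((y \<odot> z) \<odot> w) + y \<odot> ((z \<odot> x) \<odot> w) + z \<odot> ((x \<odot> y) \<odot> w) =
   (y \<odot> z) \<odot> (x \<odot> w) + (z \<odot> x) \<odot> (y \<odot> w) + (x \<odot> y) \<odot> (z \<odot> w)"
proof -
  let ?l = "x \<odot> ((y \<odot> z) \<odot> w) + y \<odot> ((z \<odot> x) \<odot> w) + z \<odot> ((x \<odot> y) \<odot> w)"
  let ?r = "(y \<odot> z) \<odot> (x \<odot> w) + (z \<odot> x) \<odot> (y \<odot> w) + (x \<odot> y) \<odot> (z \<odot> w)"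
  define d where "d u = z \<odot> ((u \<odot> u) \<odot> w) + 2 *\<^sub>R (u \<odot> ((u \<odot> z) \<odot> w))
     - ((u \<odot> u) \<odot> (z \<odot> w) + 2 *\<^sub>R ((u \<odot> z) \<odot> (u \<odot> w)))" for u
  have d0: "d u = 0" for u
    unfolding d_def by (simp add: jordan_linearized1)
  have "2 *\<^sub>R (?l - ?r) = d (x + y) - d x - d y"
    unfolding d_def
    by (simp add: jprod_bilin_simps scaleR_2 jprod_commute[of y x] jprod_commute[of z x] algebra_simps)
  then show ?thesis by (simp add: d0)
qed

text \<open>Multiplication by \<open>(x \<odot> y) \<odot> z\<close> is a polynomial in multiplications by products of at most two
  of the factors. It holds because the right hand side of the polarised identity is symmetric in all
  four variables, so that \<open>z\<close> and \<open>w\<close> may be exchanged in its left hand side.\<close>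

lemma jordan_mult_triple:
  "((x \<odot> y) \<odot> z) \<odot> w =
   x \<odot> ((y \<odot> z) \<odot> w) + y \<odot> ((z \<odot> x) \<odot> w) + z \<odot> ((x \<odot> y) \<odot> w)
   - x \<odot> (z \<odot> (y \<odot> w)) - y \<odot> (z \<odot> (x \<odot> w))"
proof -
  have "(y \<odot> z) \<odot> (x \<odot> w) + (z \<odot> x) \<odot> (y \<odot> w) + (x \<odot> y) \<odot> (z \<odot> w)
     = x \<odot> ((y \<odot> w) \<odot> z) + y \<odot> ((w \<odot> x) \<odot> z) + w \<odot> ((x \<odot> y) \<odot> z)"
    unfolding jordan_linearized2[of x y w z] by (simp add: jprod_commute algebra_simps)
  then have "x \<odot> ((y \<odot> z) \<odot> w) + y \<odot> ((z \<odot> x) \<odot> w) + z \<odot> ((x \<odot> y) \<odot> w)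
     = x \<odot> ((y \<odot> w) \<odot> z) + y \<odot> ((w \<odot> x) \<odot> z) + w \<odot> ((x \<odot> y) \<odot> z)"
    unfolding jordan_linearized2[of x y z w] .
  then show ?thesis
    by (simp add: jprod_commute[of z "y \<odot> w"] jprod_commute[of z "x \<odot> w"]
      jprod_commute[of w x] jprod_commute[of "(x \<odot> y) \<odot> z" w] algebra_simps)
qed

text \<open>The quadratic representation \<open>P(u)\<close>; for symmetric matrices with
  \<open>u \<odot> v = (u v + v u) / 2\<close> it is \<open>v \<mapsto> u v u\<close>.\<close>

definition quad_rep :: "'a \<Rightarrow> 'a \<Rightarrow> 'a" where
  "quad_rep u v = 2 *\<^sub>R (u \<odot> (u \<odot> v)) - (u \<odot> u) \<odot> v"

lemma linear_quad_rep: "linear (quad_rep u)"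
  by (rule linearI) (simp_all add: quad_rep_def jprod_bilin_simps algebra_simps)

text \<open>The left hand side is the derivative of \<open>quad_rep u v\<close> with respect to \<open>u\<close> in the
  direction \<open>a \<odot> u\<close>. This is the infinitesimal form of the equivariance of the quadratic
  representation under the flow of multiplication by \<open>a\<close>.\<close>

lemma quad_rep_derivation:
  "2 *\<^sub>R ((a \<odot> u) \<odot> (u \<odot> v) + u \<odot> ((a \<odot> u) \<odot> v)) - 2 *\<^sub>R ((u \<odot> (a \<odot> u)) \<odot> v)
   = a \<odot> quad_rep u v + quad_rep u (a \<odot> v)"
proof -
  have 1: "a \<odot> ((u \<odot> u) \<odot> v) + 2 *\<^sub>R (u \<odot> ((a \<odot> u) \<odot> v))
    = (u \<odot> u) \<odot> (a \<odot> v) + 2 *\<^sub>R ((a \<odot> u) \<odot> (u \<odot> v))"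
    using jordan_linearized1[of a u v] by (simp add: jprod_commute[of u a])
  have 2: "(u \<odot> (a \<odot> u)) \<odot> v = a \<odot> ((u \<odot> u) \<odot> v) + 2 *\<^sub>R (u \<odot> ((a \<odot> u) \<odot> v))
    - a \<odot> (u \<odot> (u \<odot> v)) - u \<odot> (u \<odot> (a \<odot> v))"
    using jordan_mult_triple[of a u u v]
    by (simp add: jprod_commute[of u "a \<odot> u"] jprod_commute[of u a] scaleR_2 algebra_simps)
  show ?thesis unfolding 2 quad_rep_def using 1
    by (simp add: jprod_bilin_simps scaleR_2 algebra_simps)
qed

section \<open>Power associativity and spectral decomposition\<close>

text \<open>The powers, with \<open>x\<^sup>n\<^sup>+\<^sup>1 = x \<odot> x\<^sup>n\<close>.\<close>

primrec jpow :: "'a \<Rightarrow> nat \<Rightarrow> 'a" where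
  "jpow x 0 = e"
| "jpow x (Suc n) = x \<odot> jpow x n"

lemma square_jprod_jpow: "(x \<odot> x) \<odot> jpow x n = jpow x (Suc (Suc n))"
  by (induction n) (simp_all add: jprod_unit_right flip: jprod_jordan)

lemma jpow_Suc_Suc_mult:
  "jpow x (Suc (Suc n)) \<odot> w =
   2 *\<^sub>R (jpow x (Suc n) \<odot> (x \<odot> w)) + (x \<odot> x) \<odot> (jpow x n \<odot> w)
   - 2 *\<^sub>R (x \<odot> (jpow x n \<odot> (x \<odot> w)))"
  using jordan_mult_triple[of x x "jpow x n" w] jordan_linearized1[of "jpow x n" x w]
  unfolding square_jprod_jpow
  by (simp add: jprod_commute[of "jpow x n" x] scaleR_2 algebra_simps)

text \<open>Multiplication by a power of \<open>x\<close> is a polynomial in the commuting multiplications by \<open>x\<close> and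
  \<open>x\<^sup>2\<close>; only the consequence for commutants is needed.\<close>

lemma jpow_multiplication_bicommutant:
  assumes T: "linear T" "\<And>w. T (x \<odot> w) = x \<odot> T w"
    "\<And>w. T ((x \<odot> x) \<odot> w) = (x \<odot> x) \<odot> T w"
  shows "T (jpow x n \<odot> w) = jpow x n \<odot> T w"
proof (induction n arbitrary: w rule: less_induct)
  case (less n)
  consider "n = 0" | "n = 1" | m where "n = Suc (Suc m)"
    by (metis One_nat_def not0_implies_Suc)
  then show ?case
  proof cases
    case 3
    then have "T (jpow x m \<odot> w) = jpow x m \<odot> T w"
      "T (jpow x (Suc m) \<odot> w) = jpow x (Suc m) \<odot> T w" for w
      using less.IH[of m] less.IH[of "Suc m"] by simp_all
    then show ?thesis
      unfolding 3 jpow_Suc_Suc_mult using T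
      by (simp add: linear_add linear_diff linear_scale del: jpow.simps)
  qed (use T in \<open>simp_all add: jprod_unit jprod_unit_right\<close>)
qed

lemma jpow_multiplications_commute:
  "jpow x m \<odot> (jpow x n \<odot> w) = jpow x n \<odot> (jpow x m \<odot> w)"
proof (rule jpow_multiplication_bicommutant)
  show "jpow x m \<odot> (x \<odot> w) = x \<odot> (jpow x m \<odot> w)" for w
    using jpow_multiplication_bicommutant[of "(\<odot>) x" x m w]
    by (simp add: linear_jprod_left jprod_jordan)
  show "jpow x m \<odot> ((x \<odot> x) \<odot> w) = (x \<odot> x) \<odot> (jpow x m \<odot> w)" for w
    using jpow_multiplication_bicommutant[of "(\<odot>) (x \<odot> x)" x m w]
    by (simp add: linear_jprod_left jprod_jordan)
qed (rule linear_jprod_left)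

lemma jpow_add: "jpow x m \<odot> jpow x n = jpow x (m + n)"
proof (induction n)
  case (Suc n)
  have "jpow x m \<odot> (jpow x 1 \<odot> jpow x n) = jpow x 1 \<odot> (jpow x m \<odot> jpow x n)"
    by (rule jpow_multiplications_commute)
  then show ?case using Suc by (simp add: jprod_unit_right)
qed (simp add: jprod_unit_right)

lemma jpow_span_closed:
  assumes "p \<in> span (range (jpow x))" "q \<in> span (range (jpow x))"
  shows "p \<odot> q \<in> span (range (jpow x))"
  using assms(2)
proof (induction q rule: span_induct)
  show "subspace {q. p \<odot> q \<in> span (range (jpow x))}"
    by (simp add: subspace_def jprod_bilin_simps span_zero span_add span_scale)
  fix q assume "q \<in> range (jpow x)"
  then obtain n where q: "q = jpow x n" by blast
  show "p \<odot> q \<in> span (range (jpow x))"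
    using assms(1) unfolding q
  proof (induction p rule: span_induct)
    show "subspace {p. p \<odot> jpow x n \<in> span (range (jpow x))}"
      by (simp add: subspace_def jprod_bilin_simps span_zero span_add span_scale)
  qed (auto simp: jpow_add intro: span_base)
qed

lemma jpow_span_multiplications_commute:
  assumes "p \<in> span (range (jpow x))" "q \<in> span (range (jpow x))"
  shows "p \<odot> (q \<odot> w) = q \<odot> (p \<odot> w)"
  using assms(2)
proof (induction q rule: span_induct)
  show "subspace {q. p \<odot> (q \<odot> w) = q \<odot> (p \<odot> w)}"
    by (simp add: subspace_def jprod_bilin_simps)
  fix q assume "q \<in> range (jpow x)"
  then obtain n where q: "q = jpow x n" by blast
  show "p \<odot> (q \<odot> w) = q \<odot> (p \<odot> w)"
    using assms(1) unfolding q
  proof (induction p rule: span_induct)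
    show "subspace {p. p \<odot> (jpow x n \<odot> w) = jpow x n \<odot> (p \<odot> w)}"
      by (simp add: subspace_def jprod_bilin_simps)
  qed (auto intro: jpow_multiplications_commute)
qed

text \<open>In an associative subalgebra, each multiplication is self-adjoint and therefore has an eigenvector
  in every nonzero ideal; its eigenspaces in the ideal are again ideals. Hence each element
  acts as a scalar on an ideal of least dimension, which is then spanned by an idempotent.
  Associativity is expressed by commuting multiplications, as the product is commutative.\<close>

lemma ideal_line:
  assumes A: "subspace A" "A \<noteq> {0}" "\<And>p q. p \<in> A \<Longrightarrow> q \<in> A \<Longrightarrow> p \<odot> q \<in> A"
    and comm: "\<And>p q r. p \<in> A \<Longrightarrow> q \<in> A \<Longrightarrow> r \<in> A \<Longrightarrow> p \<odot> (q \<odot> r) = q \<odot> (p \<odot> r)"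
  obtains c where "c \<in> A" "c \<noteq> 0" "c \<odot> c = c" "\<And>a. a \<in> A \<Longrightarrow> \<exists>l. a \<odot> c = l *\<^sub>R c"
proof -
  define ideal where "ideal B \<longleftrightarrow> subspace B \<and> B \<noteq> {0} \<and> B \<subseteq> A \<and> (\<forall>a\<in>A. \<forall>b\<in>B. a \<odot> b \<in> B)" for B
  have "ideal A" using A by (auto simp: ideal_def)
  then obtain B where B: "ideal B" and min: "\<And>B'. ideal B' \<Longrightarrow> dim B \<le> dim B'"
    using ex_has_least_nat[of ideal A dim] by blast
  have B': "subspace B" "B \<noteq> {0}" "B \<subseteq> A" "\<And>a b. a \<in> A \<Longrightarrow> b \<in> B \<Longrightarrow> a \<odot> b \<in> B"
    using B by (auto simp: ideal_def)
  have scal: "\<exists>l. \<forall>b\<in>B. a \<odot> b = l *\<^sub>R b" if a: "a \<in> A" for a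
  proof -
    obtain v l where v: "v \<in> B" "norm v = 1" "a \<odot> v = l *\<^sub>R v"
      using selfadjoint_top_eigenvector[OF linear_jprod_left jprod_self_adjoint B'(1) B'(4)[OF a] B'(2)]
      by metis
    define E where "E = {b \<in> B. a \<odot> b = l *\<^sub>R b}"
    have "subspace E" using B'(1) by (auto simp: E_def subspace_def jprod_bilin_simps algebra_simps)
    moreover have "p \<odot> b \<in> E" if "p \<in> A" "b \<in> E" for p b
      using that B'(3,4) comm[OF a, of p b] by (auto simp: E_def jprod_bilin_simps)
    moreover have "v \<in> E" "v \<noteq> 0" using v by (auto simp: E_def)
    ultimately have "ideal E" using B'(3) by (auto simp: ideal_def E_def)
    then have "E = B"
      using min[of E] B'(1) \<open>subspace E\<close> subspace_dim_equal[of E B] by (auto simp: E_def)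
    then show ?thesis by (auto simp: E_def)
  qed
  obtain b where b: "b \<in> B" "b \<noteq> 0" using B'(1,2) subspace_0 by blast
  obtain l where l: "\<forall>b'\<in>B. b \<odot> b' = l *\<^sub>R b'" using scal b(1) B'(3) by blast
  have "l \<noteq> 0" using square_nonzero[OF b(2)] l b(1) by auto
  define c where "c = (1 / l) *\<^sub>R b"
  show ?thesis
  proof
    show "c \<in> A" using b(1) B'(1,3) by (auto simp: c_def subspace_mul)
    show "c \<noteq> 0" using b \<open>l \<noteq> 0\<close> by (simp add: c_def)
    show "c \<odot> c = c" using l b(1) \<open>l \<noteq> 0\<close> by (simp add: c_def jprod_bilin_simps)
    show "\<exists>l. a \<odot> c = l *\<^sub>R c" if "a \<in> A" for a
      using scal[OF that] b(1) B'(1) by (auto simp: c_def subspace_mul)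
  qed
qed

text \<open>Splitting off the line of \<open>ideal_line\<close> leaves the annihilator of its idempotent, a subalgebra of
  smaller dimension.\<close>

lemma associative_subalgebra_idempotent_basis:
  assumes "subspace A" "\<And>p q. p \<in> A \<Longrightarrow> q \<in> A \<Longrightarrow> p \<odot> q \<in> A"
    and "\<And>p q r. p \<in> A \<Longrightarrow> q \<in> A \<Longrightarrow> r \<in> A \<Longrightarrow> p \<odot> (q \<odot> r) = q \<odot> (p \<odot> r)"
  shows "\<exists>F. finite F \<and> (\<forall>c\<in>F. c \<noteq> 0 \<and> c \<odot> c = c) \<and> (\<forall>c\<in>F. \<forall>d\<in>F. c \<noteq> d \<longrightarrow> c \<odot> d = 0) \<and> span F = A"
  using assms
proof (induction "dim A" arbitrary: A rule: less_induct)
  case less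
  show ?case
  proof (cases "A = {0}")
    case True
    then show ?thesis by (intro exI[of _ "{}"]) auto
  next
    case False
    obtain c where c: "c \<in> A" "c \<noteq> 0" "c \<odot> c = c" "\<And>a. a \<in> A \<Longrightarrow> \<exists>l. a \<odot> c = l *\<^sub>R c"
      using ideal_line[OF less.prems(1) False less.prems(2,3)] by blast
    define A' where "A' = {a \<in> A. c \<odot> a = 0}"
    have A': "subspace A'" "A' \<subseteq> A" "c \<notin> A'"
      using less.prems(1) c by (auto simp: A'_def subspace_def jprod_bilin_simps)
    have "dim A' < dim A"
      using A' c(1) less.prems(1) by (metis dim_subset le_neq_implies_less subspace_dim_equal order_refl)
    moreover have "p \<odot> q \<in> A'" if "p \<in> A'" "q \<in> A'" for p q
      using that less.prems(2) less.prems(3)[OF c(1), of p q] by (auto simp: A'_def jprod_bilin_simps)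
    moreover have "p \<odot> (q \<odot> r) = q \<odot> (p \<odot> r)" if "p \<in> A'" "q \<in> A'" "r \<in> A'" for p q r
      using that less.prems(3) by (auto simp: A'_def)
    ultimately obtain F where F: "finite F" "\<forall>c\<in>F. c \<noteq> 0 \<and> c \<odot> c = c"
      "\<forall>c\<in>F. \<forall>d\<in>F. c \<noteq> d \<longrightarrow> c \<odot> d = 0" "span F = A'"
      using less.hyps[of A'] A'(1) by blast
    have sub: "F \<subseteq> A'" using F(4) span_base by blast
    have "A \<subseteq> span (insert c F)"
    proof
      fix a assume a: "a \<in> A"
      obtain l where l: "a \<odot> c = l *\<^sub>R c" using c(4)[OF a] by blast
      have "a - l *\<^sub>R c \<in> span F"
        using a c(1,3) l less.prems(1) jprod_commute[of c a] unfolding F(4)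
        by (auto simp: A'_def jprod_bilin_simps subspace_diff subspace_mul)
      then show "a \<in> span (insert c F)" by (auto simp: span_insert)
    qed
    moreover have "span (insert c F) \<subseteq> A"
      using c(1) sub A'(2) less.prems(1) by (intro span_minimal) auto
    moreover have "c \<odot> d = 0" "d \<odot> c = 0" if "d \<in> F" for d
      using that sub jprod_commute[of d c] by (auto simp: A'_def)
    ultimately show ?thesis using F(1-3) c(2,3)
      by (intro exI[of _ "insert c F"]) auto
  qed
qed

text \<open>A finite set of pairwise orthogonal idempotents with sum \<open>e\<close>. The zero idempotent is permitted.\<close>

definition idempotent_resolution :: "'a set \<Rightarrow> bool" where
  "idempotent_resolution F \<longleftrightarrow> finite F \<and> (\<forall>c\<in>F. c \<odot> c = c) \<and>
     (\<forall>c\<in>F. \<forall>d\<in>F. c \<noteq> d \<longrightarrow> c \<odot> d = 0) \<and> \<Sum>F = e"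

text \<open>The element with eigenvalue \<open>l c\<close> on each idempotent \<open>c\<close> of \<open>F\<close>.\<close>

definition spectral_sum :: "'a set \<Rightarrow> ('a \<Rightarrow> real) \<Rightarrow> 'a" where
  "spectral_sum F l = (\<Sum>c\<in>F. l c *\<^sub>R c)"

lemma spectral_sum_jprod_idempotent:
  assumes F: "idempotent_resolution F" "c \<in> F"
  shows "spectral_sum F l \<odot> c = l c *\<^sub>R c"
proof -
  have "spectral_sum F l \<odot> c = (\<Sum>d\<in>F. l d *\<^sub>R (c \<odot> d))"
    unfolding spectral_sum_def jprod_commute[of _ c]
    by (simp add: linear_sum[OF linear_jprod_left] jprod_bilin_simps)
  also have "\<dots> = (\<Sum>d\<in>F. if d = c then l c *\<^sub>R c else 0)"
    using F by (intro sum.cong) (auto simp: idempotent_resolution_def)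
  also have "\<dots> = l c *\<^sub>R c" using F by (simp add: idempotent_resolution_def)
  finally show ?thesis .
qed

lemma spectral_sum_jprod_spectral_sum:
  assumes "idempotent_resolution F"
  shows "spectral_sum F l \<odot> spectral_sum F m = spectral_sum F (\<lambda>c. l c * m c)"
proof -
  have "spectral_sum F l \<odot> spectral_sum F m = (\<Sum>c\<in>F. m c *\<^sub>R (spectral_sum F l \<odot> c))"
    unfolding spectral_sum_def[of F m] by (simp add: linear_sum[OF linear_jprod_left] jprod_bilin_simps)
  then show ?thesis
    by (simp add: spectral_sum_jprod_idempotent[OF assms] spectral_sum_def[of F "\<lambda>c. l c * m c"] mult.commute
        cong: sum.cong)
qed

lemma spectral_sum_one: "idempotent_resolution F \<Longrightarrow> spectral_sum F (\<lambda>_. 1) = e"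
  by (simp add: spectral_sum_def idempotent_resolution_def)

lemma spectral_sum_scaleR: "r *\<^sub>R spectral_sum F l = spectral_sum F (\<lambda>c. r * l c)"
  by (simp add: spectral_sum_def scaleR_sum_right)

lemma spectral_sum_add: "spectral_sum F l + spectral_sum F m = spectral_sum F (\<lambda>c. l c + m c)"
  by (simp add: spectral_sum_def sum.distrib scaleR_add_left)

lemma spectral_sum_diff: "spectral_sum F l - spectral_sum F m = spectral_sum F (\<lambda>c. l c - m c)"
  by (simp add: spectral_sum_def sum_subtractf scaleR_diff_left)

lemma generated_subalgebra_minimal:
  assumes "A \<subseteq> S" "subspace S" "\<And>u v. u \<in> S \<Longrightarrow> v \<in> S \<Longrightarrow> u \<odot> v \<in> S"
  shows "generated_subalgebra (\<odot>) A \<subseteq> S"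
  unfolding generated_subalgebra_def using assms by (intro hull_minimal) auto

lemma generated_subalgebra_closed:
  "subspace (generated_subalgebra (\<odot>) A) \<and>
   (\<forall>u\<in>generated_subalgebra (\<odot>) A. \<forall>v\<in>generated_subalgebra (\<odot>) A.
      u \<odot> v \<in> generated_subalgebra (\<odot>) A)"
  unfolding generated_subalgebra_def by (rule hull_in) (auto intro: subspace_Inter)

lemma jpow_span_subset_generated:
  "span (range (jpow x)) \<subseteq> generated_subalgebra (\<odot>) {x, e}"
proof (rule span_minimal)
  have base: "{x, e} \<subseteq> generated_subalgebra (\<odot>) {x, e}"
    unfolding generated_subalgebra_def by (rule hull_subset)
  have "jpow x n \<in> generated_subalgebra (\<odot>) {x, e}" for n
    by (induction n) (use base generated_subalgebra_closed in auto)
  then show "range (jpow x) \<subseteq> generated_subalgebra (\<odot>) {x, e}" by auto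
qed (use generated_subalgebra_closed in auto)

text \<open>The idempotents are found in the subalgebra generated by \<open>x\<close> and \<open>e\<close>, as is needed for the
  inverse.\<close>

theorem spectral_decomposition:
  obtains F l where "idempotent_resolution F" "0 \<notin> F" "x = spectral_sum F l"
    "F \<subseteq> generated_subalgebra (\<odot>) {x, e}"
proof -
  let ?A = "span (range (jpow x))"
  obtain F where F: "finite F" "\<forall>c\<in>F. c \<noteq> 0 \<and> c \<odot> c = c"
    "\<forall>c\<in>F. \<forall>d\<in>F. c \<noteq> d \<longrightarrow> c \<odot> d = 0" "span F = ?A"
    using associative_subalgebra_idempotent_basis[of ?A]
    using jpow_span_closed jpow_span_multiplications_commute by auto
  have "jpow x n \<in> span F" for n unfolding F(4) by (simp add: span_base)
  from this[of 0] this[of 1] have "e \<in> span F" "x \<in> span F" by (auto simp: jprod_unit_right)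
  then obtain u l where u: "e = spectral_sum F u" and l: "x = spectral_sum F l"
    unfolding span_finite[OF F(1)] spectral_sum_def by auto
  have "c = u c *\<^sub>R c" if "c \<in> F" for c
  proof -
    have "c = spectral_sum F u \<odot> c" using jprod_unit u by simp
    also have "\<dots> = (\<Sum>d\<in>F. u d *\<^sub>R (c \<odot> d))"
      unfolding spectral_sum_def jprod_commute[of _ c]
      by (simp add: linear_sum[OF linear_jprod_left] jprod_bilin_simps)
    also have "\<dots> = (\<Sum>d\<in>F. if d = c then u c *\<^sub>R c else 0)"
      using F that by (intro sum.cong) auto
    finally show ?thesis using F(1) that by simp
  qed
  then have "\<Sum>F = e" unfolding u spectral_sum_def by (intro sum.cong) auto
  then have "idempotent_resolution F" using F by (simp add: idempotent_resolution_def)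
  moreover have "F \<subseteq> generated_subalgebra (\<odot>) {x, e}"
    using F(4) jpow_span_subset_generated[of x] span_superset[of F] by blast
  moreover have "0 \<notin> F" using F(2) by blast
  ultimately show ?thesis using that[of F l] l by blast
qed

end

section \<open>The cone of squares\<close>

context euclidean_jordan_algebra
begin

text \<open>The multiplication \<open>L\<close> by an idempotent satisfies \<open>2 L\<^sup>3 - 3 L\<^sup>2 + L = 0\<close>, so its eigenvalues are
  among \<open>0\<close>, \<open>1/2\<close> and \<open>1\<close>.\<close>

lemma idempotent_multiplication_psd:
  assumes c: "c \<odot> c = c"
  shows "0 \<le> (c \<odot> w) \<bullet> w"
proof -
  \<comment> \<open>The top eigenvalue \<open>l\<close> of \<open>f\<close> is minus the least eigenvalue \<open>k\<close> of the multiplication.\<close>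
  define f where "f v = - (c \<odot> v)" for v
  have lin: "linear f" unfolding f_def by (intro linear_compose_neg linear_jprod_left)
  have sa: "f x \<bullet> y = x \<bullet> f y" for x y by (simp add: f_def jprod_self_adjoint)
  have ne: "(UNIV :: 'a set) \<noteq> {0}" using e_nonzero by blast
  obtain v l where v: "norm v = 1" "f v = l *\<^sub>R v" and max: "\<And>w. f w \<bullet> w \<le> l * (w \<bullet> w)"
    using selfadjoint_top_eigenvector[OF lin sa subspace_UNIV _ ne] by auto
  define k where "k = - l"
  have cv: "c \<odot> v = k *\<^sub>R v" using v(2) by (simp add: f_def k_def equation_minus_iff)
  have "c \<odot> v - (c \<odot> (c \<odot> v) + c \<odot> (c \<odot> v) + c \<odot> (c \<odot> v)
      - c \<odot> (c \<odot> (c \<odot> v)) - c \<odot> (c \<odot> (c \<odot> v))) = 0"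
    using jordan_mult_triple[of c c c v] unfolding c by (simp only: right_minus_eq)
  then have "k *\<^sub>R v - ((k * k) *\<^sub>R v + (k * k) *\<^sub>R v + (k * k) *\<^sub>R v
      - (k * k * k) *\<^sub>R v - (k * k * k) *\<^sub>R v) = 0"
    by (simp only: cv jprod_bilin_simps scaleR_scaleR mult.assoc)
  then have "(k - (k * k + k * k + k * k - k * k * k - k * k * k)) *\<^sub>R v = 0"
    by (simp only: scaleR_diff_left scaleR_add_left)
  then have "k - (k * k + k * k + k * k - k * k * k - k * k * k) = 0"
    using v(1) by (metis norm_zero scaleR_eq_0_iff zero_neq_one)
  then have "k * ((1 - k) * (1 - 2 * k)) = 0" by (simp add: algebra_simps)
  then have "0 \<le> k" by auto
  then have "l * (w \<bullet> w) \<le> 0" by (simp add: k_def mult_nonpos_nonneg)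
  then show ?thesis using max[of w] by (simp add: f_def)
qed

lemma idempotents_orthogonal:
  assumes "c \<odot> c = c" "d \<odot> d = d" "c \<bullet> d = 0"
  shows "c \<odot> d = 0"
proof (rule psd_kernel[where g = "(\<odot>) c" and S = UNIV])
  show "(c \<odot> d) \<bullet> d = 0"
    using jprod_self_adjoint[of d c d] assms(2,3) jprod_commute[of d c] by simp
  show "0 \<le> (c \<odot> w) \<bullet> w" for w by (rule idempotent_multiplication_psd[OF assms(1)])
qed (simp_all add: linear_jprod_left jprod_self_adjoint)

lemma square_inner_idempotent: "c \<odot> c = c \<Longrightarrow> 0 \<le> (x \<odot> x) \<bullet> c"
  using jprod_self_adjoint[of x x c] idempotent_multiplication_psd[of c x]
  by (simp add: jprod_commute inner_commute)

lemma idempotent_inner_self: "c \<odot> c = c \<Longrightarrow> c \<bullet> c = c \<bullet> e"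
  by (metis inner_jprod_e)

lemma spectral_sum_inner:
  assumes "idempotent_resolution F" "c \<in> F"
  shows "spectral_sum F l \<bullet> c = l c * (c \<bullet> c)"
  using inner_jprod_e[of "spectral_sum F l" c] assms
  by (simp add: spectral_sum_jprod_idempotent idempotent_inner_self idempotent_resolution_def)

abbreviation "sqcone \<equiv> square_cone (\<odot>)"

lemma square_in_cone: "x \<odot> x \<in> sqcone" by (simp add: square_cone_def)

lemma idempotent_in_cone: "c \<odot> c = c \<Longrightarrow> c \<in> sqcone"
  using square_in_cone[of c] by simp

lemma cone_inner_idempotent: "x \<in> sqcone \<Longrightarrow> c \<odot> c = c \<Longrightarrow> 0 \<le> x \<bullet> c"
  by (auto simp: square_cone_def square_inner_idempotent)

lemma spectral_sum_in_cone:
  assumes F: "idempotent_resolution F" and l: "\<And>c. c \<in> F \<Longrightarrow> 0 \<le> l c"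
  shows "spectral_sum F l \<in> sqcone"
proof -
  have "spectral_sum F (\<lambda>c. sqrt (l c)) \<odot> spectral_sum F (\<lambda>c. sqrt (l c)) = spectral_sum F (\<lambda>c. sqrt (l c) * sqrt (l c))"
    by (rule spectral_sum_jprod_spectral_sum[OF F])
  also have "\<dots> = spectral_sum F l" unfolding spectral_sum_def by (intro sum.cong) (simp_all add: l)
  finally show ?thesis by (metis square_in_cone)
qed

lemma spectral_sum_in_cone_iff:
  assumes F: "idempotent_resolution F" and nz: "0 \<notin> F"
  shows "spectral_sum F l \<in> sqcone \<longleftrightarrow> (\<forall>c\<in>F. 0 \<le> l c)"
proof
  assume x: "spectral_sum F l \<in> sqcone"
  show "\<forall>c\<in>F. 0 \<le> l c"
  proof
    fix c assume c: "c \<in> F"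
    have "0 \<le> l c * (c \<bullet> c)"
      using cone_inner_idempotent[OF x, of c] spectral_sum_inner[OF F c] F c
      by (simp add: idempotent_resolution_def)
    moreover have "0 < c \<bullet> c" using nz c by auto
    ultimately show "0 \<le> l c" by (simp add: zero_le_mult_iff)
  qed
qed (auto intro: spectral_sum_in_cone[OF F])

text \<open>The squares are characterised by linear inequalities, so they form a closed convex cone.\<close>

lemma cone_iff: "x \<in> sqcone \<longleftrightarrow> (\<forall>c. c \<odot> c = c \<longrightarrow> 0 \<le> x \<bullet> c)"
proof
  assume *: "\<forall>c. c \<odot> c = c \<longrightarrow> 0 \<le> x \<bullet> c"
  obtain F l where F: "idempotent_resolution F" "0 \<notin> F" "x = spectral_sum F l"
    "F \<subseteq> generated_subalgebra (\<odot>) {x, e}"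
    by (rule spectral_decomposition[of x])
  have "0 \<le> l c" if c: "c \<in> F" for c
  proof -
    have "c \<odot> c = c" using F(1) c by (simp add: idempotent_resolution_def)
    then have "0 \<le> x \<bullet> c" using * by blast
    then have "0 \<le> l c * (c \<bullet> c)" unfolding F(3) spectral_sum_inner[OF F(1) c] .
    moreover have "0 < c \<bullet> c" using F(2) c by auto
    ultimately show "0 \<le> l c" by (simp add: zero_le_mult_iff)
  qed
  then show "x \<in> sqcone" unfolding F(3) by (rule spectral_sum_in_cone[OF F(1)])
qed (auto simp: cone_inner_idempotent)

lemma closed_cone: "closed sqcone"
proof -
  have "sqcone = (\<Inter>c\<in>{c. c \<odot> c = c}. {x. 0 \<le> x \<bullet> c})" using cone_iff by auto
  then show ?thesis by (auto intro!: closed_INT closed_Collect_le continuous_intros)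
qed

lemma cone_add: "x \<in> sqcone \<Longrightarrow> y \<in> sqcone \<Longrightarrow> x + y \<in> sqcone"
  by (simp add: cone_iff inner_add)

lemma cone_scaleR: "x \<in> sqcone \<Longrightarrow> 0 \<le> r \<Longrightarrow> r *\<^sub>R x \<in> sqcone"
  by (simp add: cone_iff)

lemma cone_inner: assumes "x \<in> sqcone" "y \<in> sqcone" shows "0 \<le> x \<bullet> y"
proof -
  obtain F l where F: "idempotent_resolution F" "0 \<notin> F" "y = spectral_sum F l"
    "F \<subseteq> generated_subalgebra (\<odot>) {y, e}"
    by (rule spectral_decomposition[of y])
  then have "\<forall>c\<in>F. 0 \<le> l c" using assms(2) spectral_sum_in_cone_iff[OF F(1,2), of l] by simp
  moreover have "\<forall>c\<in>F. 0 \<le> x \<bullet> c"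
    using F(1) assms(1) by (simp add: cone_inner_idempotent idempotent_resolution_def)
  ultimately show ?thesis unfolding F(3) spectral_sum_def by (simp add: inner_sum_right sum_nonneg)
qed

text \<open>A nonzero idempotent \<open>c\<close> satisfies \<open>norm c \<ge> 1 / K\<close> for a bound \<open>K\<close> of the product, so
  perturbations of \<open>e\<close> of norm less than \<open>1 / K\<close> keep all the inequalities.\<close>

lemma e_interior_cone: "e \<in> interior sqcone"
proof -
  have "\<exists>K>0. \<forall>x y. norm (x \<odot> y) \<le> norm x * norm y * K"
    by (rule bounded_bilinear.pos_bounded[OF bounded_bilinear_jprod])
  then obtain K where "K > 0" "\<forall>x y. norm (x \<odot> y) \<le> norm x * norm y * K" by blast
  then have K: "K > 0" "\<And>x y. norm (x \<odot> y) \<le> norm x * norm y * K" by simp_all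
  have "ball e (1 / K) \<subseteq> sqcone"
  proof
    fix x assume "x \<in> ball e (1 / K)"
    then have x: "norm (x - e) < 1 / K" by (simp add: dist_norm norm_minus_commute)
    have "0 \<le> x \<bullet> c" if c: "c \<odot> c = c" for c
    proof (cases "c = 0")
      case False
      have "norm c * 1 \<le> norm c * (norm c * K)" using K(2)[of c c] c by (simp add: mult.assoc)
      then have "1 / K \<le> norm c" using False K(1) by (simp add: field_simps)
      then have "norm (x - e) * norm c \<le> norm c * norm c"
        using x by (intro mult_right_mono) auto
      then have "\<bar>(x - e) \<bullet> c\<bar> \<le> c \<bullet> c"
        using Cauchy_Schwarz_ineq2[of "x - e" c] by (simp add: dot_square_norm power2_eq_square)
      moreover have "(x - e) \<bullet> c = x \<bullet> c - c \<bullet> c"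
        by (simp only: inner_diff_left inner_commute[of e c] idempotent_inner_self[OF c])
      ultimately show ?thesis by linarith
    qed simp
    then show "x \<in> sqcone" by (simp add: cone_iff)
  qed
  then show ?thesis using K(1) by (auto simp: mem_interior intro!: exI[of _ "1 / K"])
qed

end

section \<open>Closed cones with nonnegative inner products\<close>

text \<open>A closed convex cone contained in its dual cone, with a chosen interior point. Pointedness
  follows.\<close>

locale acute_cone =
  fixes C :: "'a::euclidean_space set" and e :: 'a
  assumes closed_C: "closed C"
    and add_C: "\<And>x y. x \<in> C \<Longrightarrow> y \<in> C \<Longrightarrow> x + y \<in> C"
    and scale_C: "\<And>x r. x \<in> C \<Longrightarrow> 0 \<le> r \<Longrightarrow> r *\<^sub>R x \<in> C"
    and inner_C: "\<And>x y. x \<in> C \<Longrightarrow> y \<in> C \<Longrightarrow> 0 \<le> x \<bullet> y"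
    and e_interior: "e \<in> interior C"
begin

lemma interior_in_C: "x \<in> interior C \<Longrightarrow> x \<in> C"
  using interior_subset by blast

lemma zero_in_C: "0 \<in> C"
  using scale_C[OF interior_in_C[OF e_interior], of 0] by simp

lemma pointed: assumes "x \<in> C" "- x \<in> C" shows "x = 0"
  using inner_C[OF assms] by (metis inner_ge_zero inner_gt_zero_iff inner_minus_right neg_0_le_iff_le not_less)

lemma interior_add:
  assumes x: "x \<in> interior C" and y: "y \<in> C"
  shows "x + y \<in> interior C"
proof -
  have "(\<lambda>z. y + z) ` interior C \<subseteq> interior C"
  proof (rule interior_maximal)
    show "(\<lambda>z. y + z) ` interior C \<subseteq> C" using y add_C interior_in_C by blast
    show "open ((\<lambda>z. y + z) ` interior C)" by (rule open_translation) simp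
  qed
  then show ?thesis using x by (auto simp: add.commute)
qed

lemma interior_scale:
  assumes x: "x \<in> interior C" and r: "0 < r"
  shows "r *\<^sub>R x \<in> interior C"
proof -
  have "(\<lambda>z. r *\<^sub>R z) ` interior C \<subseteq> interior C"
  proof (rule interior_maximal)
    show "(\<lambda>z. r *\<^sub>R z) ` interior C \<subseteq> C" using r scale_C interior_in_C by fastforce
    show "open ((\<lambda>z. r *\<^sub>R z) ` interior C)" using r by (intro open_scaling) auto
  qed
  then show ?thesis using x by auto
qed

lemma interior_absorb:
  assumes "u \<in> interior C"
  obtains r where "0 < r" "u - r *\<^sub>R v \<in> interior C"
proof -
  have "((\<lambda>r. u - r *\<^sub>R v) \<longlongrightarrow> u - 0 *\<^sub>R v) (at_right 0)" by (intro tendsto_intros)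
  then have "\<forall>\<^sub>F r in at_right 0. u - r *\<^sub>R v \<in> interior C"
    using assms by (auto intro!: topological_tendstoD)
  then have "\<forall>\<^sub>F r in at_right 0. 0 < r \<and> u - r *\<^sub>R v \<in> interior C"
    using eventually_at_right_less[of "0::real"] by eventually_elim auto
  then show ?thesis using that eventually_happens' trivial_limit_at_right_real by blast
qed

lemma e_neq_0: "e \<noteq> 0"
proof
  assume "e = 0"
  obtain b :: 'a where b: "b \<in> Basis" using nonempty_Basis by blast
  obtain r where r: "0 < r" "e - r *\<^sub>R b \<in> interior C" using interior_absorb[OF e_interior] by blast
  obtain s where s: "0 < s" "e - s *\<^sub>R (- b) \<in> interior C" using interior_absorb[OF e_interior] by blast
  have "0 \<le> (e - r *\<^sub>R b) \<bullet> (e - s *\<^sub>R (- b))" using r s by (intro inner_C interior_in_C)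
  then have "0 \<le> - (r * s)" using b \<open>e = 0\<close> by (simp add: mult.commute)
  then show False using r s by (simp add: mult_le_0_iff)
qed

lemma interior_nonzero: assumes "x \<in> interior C" shows "x \<noteq> 0"
proof
  assume "x = 0"
  obtain r where r: "0 < r" "x - r *\<^sub>R e \<in> interior C" using interior_absorb[OF assms] by blast
  then have "r *\<^sub>R e \<in> C" using e_interior by (intro scale_C interior_in_C) auto
  moreover have "- (r *\<^sub>R e) \<in> C" using r(2) \<open>x = 0\<close> interior_in_C by fastforce
  ultimately show False using pointed e_neq_0 r by fastforce
qed

lemma norm_le_of_order_bounds:
  assumes "b - v \<in> C" "b + v \<in> C"
  shows "norm v \<le> norm b"
proof -
  have "v \<bullet> v \<le> b \<bullet> b"
    using inner_C[OF assms]
    by (simp add: inner_diff_left inner_add_right inner_commute[of v b])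
  then show ?thesis by (simp add: norm_le)
qed

text \<open>The infimum defining \<open>M(x/y)\<close> is attained, and is the threshold of a closed upper half-line.\<close>

lemma cone_M_le_iff:
  assumes y: "y \<in> interior C"
  shows "cone_M C x y \<le> b \<longleftrightarrow> b *\<^sub>R y - x \<in> C"
proof -
  define B where "B = {b. b *\<^sub>R y - x \<in> C}"
  have M: "cone_M C x y = Inf B" by (simp add: cone_M_def cone_le_def B_def)
  have yy: "0 < y \<bullet> y" using interior_nonzero[OF y] by simp
  have up: "b' \<in> B" if "b \<in> B" "b \<le> b'" for b b'
    using add_C[of "b *\<^sub>R y - x" "(b' - b) *\<^sub>R y"] scale_C[of y "b' - b"] that interior_in_C[OF y]
    by (simp add: B_def algebra_simps)
  have ne: "B \<noteq> {}"
  proof -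
    obtain r where r: "0 < r" "y - r *\<^sub>R x \<in> interior C" using interior_absorb[OF y] by blast
    have "(1 / r) *\<^sub>R (y - r *\<^sub>R x) \<in> C" using r by (intro scale_C interior_in_C) auto
    then show ?thesis using r(1) by (auto simp: B_def scaleR_diff_right)
  qed
  have "(x \<bullet> y) / (y \<bullet> y) \<le> b" if "b \<in> B" for b
  proof -
    have "0 \<le> (b *\<^sub>R y - x) \<bullet> y" using that y by (auto simp: B_def intro!: inner_C interior_in_C)
    then show ?thesis using yy by (simp add: inner_diff_left field_simps)
  qed
  then have bdd: "bdd_below B" by (rule bdd_belowI)
  have "closed B"
  proof -
    have "B = (\<lambda>b. b *\<^sub>R y - x) -` C" by (auto simp: B_def)
    then show ?thesis
      by (auto intro!: continuous_closed_vimage closed_C continuous_intros)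
  qed
  then have "Inf B \<in> B" using closed_contains_Inf[OF ne bdd] by blast
  then have "cone_M C x y \<le> b \<longleftrightarrow> b \<in> B"
    unfolding M using up cInf_lower[OF _ bdd] by blast
  then show ?thesis by (simp add: B_def)
qed

lemma cone_M_eqI:
  assumes "\<And>b. cone_M C x y \<le> b \<longleftrightarrow> m \<le> b"
  shows "cone_M C x y = m"
  using assms by (meson antisym order_refl)

lemma cone_M_less_iff:
  assumes y: "y \<in> interior C"
  shows "cone_M C x y < b \<longleftrightarrow> b *\<^sub>R y - x \<in> interior C"
proof
  assume *: "cone_M C x y < b"
  let ?m = "cone_M C x y"
  have "(b - ?m) *\<^sub>R y + (?m *\<^sub>R y - x) \<in> interior C"
    using * y by (intro interior_add interior_scale) (auto simp flip: cone_M_le_iff)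
  then show "b *\<^sub>R y - x \<in> interior C" by (simp add: algebra_simps)
next
  assume "b *\<^sub>R y - x \<in> interior C"
  then obtain r where r: "0 < r" "b *\<^sub>R y - x - r *\<^sub>R y \<in> interior C" by (rule interior_absorb)
  then have "(b - r) *\<^sub>R y - x \<in> C"
    using interior_in_C by (force simp: algebra_simps)
  then have "cone_M C x y \<le> b - r" by (simp add: cone_M_le_iff[OF y])
  then show "cone_M C x y < b" using r by simp
qed

lemma cone_M_upper: "y \<in> interior C \<Longrightarrow> cone_M C x y *\<^sub>R y - x \<in> C"
  using cone_M_le_iff[of y x "cone_M C x y"] by simp

lemma cone_M_self: assumes "x \<in> interior C" shows "cone_M C x x = 1"
proof (rule cone_M_eqI)
  fix b
  show "cone_M C x x \<le> b \<longleftrightarrow> 1 \<le> b"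
  proof
    assume "cone_M C x x \<le> b"
    then have *: "(b - 1) *\<^sub>R x \<in> C" using assms by (simp add: cone_M_le_iff scaleR_diff_left)
    show "1 \<le> b"
    proof (rule ccontr)
      assume "\<not> 1 \<le> b"
      then have "- ((b - 1) *\<^sub>R x) \<in> C"
        using scale_C[OF interior_in_C[OF assms], of "1 - b"] by (simp add: algebra_simps)
      from pointed[OF * this] show False
        using interior_nonzero[OF assms] \<open>\<not> 1 \<le> b\<close> by simp
    qed
  next
    assume "1 \<le> b"
    then show "cone_M C x x \<le> b"
      using assms scale_C[OF interior_in_C[OF assms], of "b - 1"]
      by (simp add: cone_M_le_iff scaleR_diff_left)
  qed
qed

lemma cone_M_scale_left:
  assumes y: "y \<in> interior C" and r: "0 < r"
  shows "cone_M C (r *\<^sub>R x) y = r * cone_M C x y"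
proof (rule cone_M_eqI)
  fix b
  have "b *\<^sub>R y - r *\<^sub>R x \<in> C \<longleftrightarrow> (b / r) *\<^sub>R y - x \<in> C"
    using scale_C[of "b *\<^sub>R y - r *\<^sub>R x" "1 / r"] scale_C[of "(b / r) *\<^sub>R y - x" r] r
    by (auto simp: scaleR_diff_right)
  then show "cone_M C (r *\<^sub>R x) y \<le> b \<longleftrightarrow> r * cone_M C x y \<le> b"
    using r by (simp add: cone_M_le_iff[OF y, symmetric] field_simps)
qed

lemma cone_M_nonneg:
  assumes y: "y \<in> interior C" and x: "x \<in> C"
  shows "0 \<le> cone_M C x y"
proof (rule ccontr)
  let ?m = "cone_M C x y"
  assume "\<not> 0 \<le> ?m"
  then have "(- ?m) *\<^sub>R y \<in> C" using y by (intro scale_C interior_in_C) auto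
  moreover have "?m *\<^sub>R y \<in> C" using add_C[OF cone_M_upper[OF y, of x] x] by simp
  ultimately have "?m *\<^sub>R y = 0" by (intro pointed) auto
  then show False using interior_nonzero[OF y] \<open>\<not> 0 \<le> ?m\<close> by simp
qed

lemma cone_M_pos:
  assumes y: "y \<in> interior C" and x: "x \<in> C" "x \<noteq> 0"
  shows "0 < cone_M C x y"
proof -
  have "cone_M C x y \<noteq> 0" using cone_M_upper[OF y, of x] pointed x by auto
  then show ?thesis using cone_M_nonneg[OF y x(1)] by simp
qed

lemma cone_M_interior_pos:
  "x \<in> interior C \<Longrightarrow> y \<in> interior C \<Longrightarrow> 0 < cone_M C x y"
  by (simp add: cone_M_pos interior_in_C interior_nonzero)

lemma cone_M_triangle:
  assumes "x \<in> C" "y \<in> interior C" "z \<in> interior C"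
  shows "cone_M C x z \<le> cone_M C x y * cone_M C y z"
proof -
  let ?m = "cone_M C x y" and ?n = "cone_M C y z"
  have "(?m *\<^sub>R y - x) + ?m *\<^sub>R (?n *\<^sub>R z - y) \<in> C"
    using assms by (intro add_C scale_C cone_M_upper cone_M_nonneg)
  then show ?thesis using assms by (simp add: cone_M_le_iff algebra_simps)
qed

text \<open>The sublevel sets are described by open conditions, the superlevel sets by complements of closed
  ones.\<close>

lemma continuous_on_cone_M:
  "continuous_on (UNIV \<times> interior C) (\<lambda>p. cone_M C (fst p) (snd p))"
  unfolding continuous_on_def
proof (intro ballI order_tendstoI)
  fix p :: "'a \<times> 'a" and a assume p: "p \<in> UNIV \<times> interior C"
  have ev: "\<forall>\<^sub>F q in at p within UNIV \<times> interior C. q \<in> UNIV \<times> interior C"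
    by (simp add: eventually_at_filter)
  have lim: "((\<lambda>q. a *\<^sub>R snd q - fst q) \<longlongrightarrow> a *\<^sub>R snd p - fst p) (at p within UNIV \<times> interior C)"
    by (intro tendsto_intros tendsto_ident_at)
  {
    assume "a < cone_M C (fst p) (snd p)"
    then have "a *\<^sub>R snd p - fst p \<in> - C" using p by (auto simp flip: cone_M_le_iff)
    then have "\<forall>\<^sub>F q in at p within UNIV \<times> interior C. a *\<^sub>R snd q - fst q \<in> - C"
      using closed_C by (intro topological_tendstoD[OF lim]) (auto simp: open_Compl)
    then show "\<forall>\<^sub>F q in at p within UNIV \<times> interior C. a < cone_M C (fst q) (snd q)"
      using ev by eventually_elim (auto simp flip: cone_M_le_iff)
  next
    assume "cone_M C (fst p) (snd p) < a"
    then have "a *\<^sub>R snd p - fst p \<in> interior C" using p by (auto simp: cone_M_less_iff)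
    then have "\<forall>\<^sub>F q in at p within UNIV \<times> interior C. a *\<^sub>R snd q - fst q \<in> interior C"
      by (intro topological_tendstoD[OF lim]) auto
    then show "\<forall>\<^sub>F q in at p within UNIV \<times> interior C. cone_M C (fst q) (snd q) < a"
      using ev by eventually_elim (auto simp: cone_M_less_iff)
  }
qed

lemma continuous_on_cone_M_compose:
  assumes "continuous_on S f" "continuous_on S g" "\<And>s. s \<in> S \<Longrightarrow> g s \<in> interior C"
  shows "continuous_on S (\<lambda>s. cone_M C (f s) (g s))"
  using continuous_on_compose2[OF continuous_on_cone_M continuous_on_Pair[OF assms(1,2)]] assms(3)
  by auto

section \<open>The topology of the Thompson metric\<close>

lemma max_cone_M_ge_1:
  assumes "x \<in> interior C" "y \<in> interior C"
  shows "1 \<le> max (cone_M C x y) (cone_M C y x)"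
proof (rule ccontr)
  assume "\<not> ?thesis"
  then have "cone_M C x y * cone_M C y x < 1 * 1"
    using cone_M_interior_pos assms by (intro mult_strict_mono) (auto intro: less_imp_le)
  moreover have "1 \<le> cone_M C x y * cone_M C y x"
    using cone_M_triangle[of x y x] assms by (simp add: cone_M_self interior_in_C)
  ultimately show False by simp
qed

lemma Metric_space_thompson: "Metric_space (interior C) (thompson_dist C)"
proof
  fix x y z
  show "0 \<le> thompson_dist C x y"
    using max_cone_M_ge_1[of x y] by (auto simp: thompson_dist_def)
  show "thompson_dist C x y = thompson_dist C y x"
    by (simp add: thompson_dist_def max.commute)
  assume x: "x \<in> interior C" and y: "y \<in> interior C"
  show "thompson_dist C x y = 0 \<longleftrightarrow> x = y"
  proof
    assume "thompson_dist C x y = 0"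
    then have "max (cone_M C x y) (cone_M C y x) = 1"
      using x y max_cone_M_ge_1[of x y] by (simp add: thompson_dist_def)
    then have "cone_M C x y \<le> 1" "cone_M C y x \<le> 1"
      by (metis max.cobounded1, metis max.cobounded2)
    then have "y - x \<in> C" "- (y - x) \<in> C" using x y by (auto simp: cone_M_le_iff)
    then show "x = y" using pointed by fastforce
  qed (use x in \<open>simp add: thompson_dist_def cone_M_self\<close>)
  assume z: "z \<in> interior C"
  let ?m = "\<lambda>x y. max (cone_M C x y) (cone_M C y x)"
  have pos: "0 < ?m x y" "0 < ?m y z" "0 < ?m x z"
    using x y z cone_M_interior_pos by (auto simp: less_max_iff_disj)
  have "cone_M C x z \<le> ?m x y * ?m y z" "cone_M C z x \<le> ?m y z * ?m x y"
    using cone_M_triangle[of x y z] cone_M_triangle[of z y x] x y z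
      mult_mono[of "cone_M C x y" "?m x y" "cone_M C y z" "?m y z"]
      mult_mono[of "cone_M C z y" "?m y z" "cone_M C y x" "?m x y"]
      cone_M_interior_pos[OF y z] cone_M_interior_pos[OF y x] pos
    by (auto simp: interior_in_C intro: order_trans less_imp_le)
  then have "?m x z \<le> ?m x y * ?m y z" by (simp add: mult.commute)
  then have "ln (?m x z) \<le> ln (?m x y * ?m y z)" using pos by (subst ln_le_cancel_iff) auto
  also have "\<dots> = ln (?m x y) + ln (?m y z)" using pos by (intro ln_mult_pos)
  finally show "thompson_dist C x z \<le> thompson_dist C x y + thompson_dist C y z"
    using x y z by (simp add: thompson_dist_def)
qed

lemma thompson_dist_less_iff:
  assumes x: "x \<in> interior C" and y: "y \<in> interior C" and q: "0 < q"
  shows "thompson_dist C x y < ln q \<longleftrightarrow> q *\<^sub>R y - x \<in> interior C \<and> q *\<^sub>R x - y \<in> interior C"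
  using x y q cone_M_interior_pos
  by (simp add: thompson_dist_def less_max_iff_disj flip: cone_M_less_iff)

theorem thompson_topology_eq: "thompson_topology C = top_of_set (interior C)"
  unfolding topology_eq
proof
  fix U
  interpret T: Metric_space "interior C" "thompson_dist C" by (rule Metric_space_thompson)
  show "openin (thompson_topology C) U \<longleftrightarrow> openin (top_of_set (interior C)) U"
    unfolding thompson_topology_def T.openin_mtopology openin_euclidean_subtopology_iff
  proof (intro conj_cong refl iffI allI impI ballI)
    fix x assume U: "U \<subseteq> interior C" and *: "\<forall>x. x \<in> U \<longrightarrow> (\<exists>r>0. T.mball x r \<subseteq> U)" and x: "x \<in> U"
    then obtain r where r: "r > 0" "T.mball x r \<subseteq> U" by blast
    have xi: "x \<in> interior C" using U x by blast
    define V where "V = {y. exp r *\<^sub>R y - x \<in> interior C} \<inter> {y. exp r *\<^sub>R x - y \<in> interior C}"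
    \<comment> \<open>\<open>V\<close> meets the interior of \<open>C\<close> in the Thompson ball of radius \<open>r\<close>.\<close>
    have "open V"
      unfolding V_def
      by (intro open_Int open_vimage[unfolded vimage_def] open_interior continuous_intros)
    moreover have "x \<in> V"
      using interior_scale[OF xi, of "exp r - 1"] r(1) by (simp add: V_def scaleR_diff_left)
    ultimately obtain d where d: "d > 0" "\<And>y. dist y x < d \<Longrightarrow> y \<in> V"
      unfolding open_dist by blast
    show "\<exists>d>0. \<forall>y\<in>interior C. dist y x < d \<longrightarrow> y \<in> U"
    proof (intro exI[of _ d] conjI ballI impI)
      fix y assume y: "y \<in> interior C" "dist y x < d"
      then have "thompson_dist C x y < ln (exp r)"
        using d(2) by (subst thompson_dist_less_iff) (auto simp: xi V_def)
      then show "y \<in> U" using r(2) xi y(1) by auto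
    qed (rule d(1))
  next
    fix x assume U: "U \<subseteq> interior C"
      and *: "\<forall>x\<in>U. \<exists>d>0. \<forall>y\<in>interior C. dist y x < d \<longrightarrow> y \<in> U" and x: "x \<in> U"
    then obtain d where d: "d > 0" "\<And>y. y \<in> interior C \<Longrightarrow> dist y x < d \<Longrightarrow> y \<in> U" by meson
    have xi: "x \<in> interior C" using U x by blast
    define s where "s = d / (norm x + 1)"
    have s: "s > 0" "s * norm x < d"
      using d(1) by (auto simp: s_def field_simps add_pos_nonneg add_nonneg_pos)
    define q where "q = 1 + s"
    show "\<exists>r>0. T.mball x r \<subseteq> U"
    proof (intro exI[of _ "ln q"] conjI subsetI)
      show "0 < ln q" using s by (simp add: q_def)
      fix y assume "y \<in> T.mball x (ln q)"
      then have y: "y \<in> interior C" "thompson_dist C x y < ln q" by auto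
      then have b: "q *\<^sub>R y - x \<in> C" "q *\<^sub>R x - y \<in> C"
        using thompson_dist_less_iff[OF xi y(1), of q] s interior_in_C by (auto simp: q_def)
      have "s *\<^sub>R x - (y - x) \<in> C" using b(2) by (simp add: q_def algebra_simps)
      moreover have "s *\<^sub>R x + (y - x) \<in> C"
      proof -
        \<comment> \<open>From \<open>y \<ge> x / q\<close>, since \<open>1 / q - (1 - s) = s\<^sup>2 / q\<close> for \<open>q = 1 + s\<close>.\<close>
        have "(1 / q) *\<^sub>R (q *\<^sub>R y - x) + (s^2 / q) *\<^sub>R x \<in> C"
          using s by (intro add_C scale_C b(1) interior_in_C[OF xi]) (auto simp: q_def)
        moreover have "(1 / q) *\<^sub>R (q *\<^sub>R y - x) + (s^2 / q) *\<^sub>R x = y + ((s^2 - 1) / q) *\<^sub>R x"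
          using s by (simp add: q_def scaleR_diff_right diff_divide_distrib scaleR_diff_left)
        moreover have "(s^2 - 1) / q = s - 1"
          using s by (simp add: q_def field_simps power2_eq_square)
        ultimately have "y + (s - 1) *\<^sub>R x \<in> C" by metis
        then show ?thesis by (simp add: algebra_simps)
      qed
      ultimately have "norm (y - x) \<le> norm (s *\<^sub>R x)" by (rule norm_le_of_order_bounds)
      then have "dist y x < d" using s by (simp add: dist_norm)
      then show "y \<in> U" using d y by blast
    qed
  qed
qed

section \<open>The unit slice\<close>

text \<open>The elements of the cone of order unit norm one.\<close>

definition unit_slice :: "'a set" where
  "unit_slice = {y \<in> C. cone_M C y e = 1}"

lemma order_unit_norm_eq_cone_M:
  assumes x: "x \<in> C"
  shows "order_unit_norm C e x = cone_M C x e"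
proof -
  have eC: "e \<in> C" by (rule interior_in_C[OF e_interior])
  have "{l. 0 \<le> l \<and> cone_le C (- (l *\<^sub>R e)) x \<and> cone_le C x (l *\<^sub>R e)} = {cone_M C x e..}"
  proof (intro set_eqI)
    fix l
    have "x + l *\<^sub>R e \<in> C" if "0 \<le> l" using x eC that by (intro add_C scale_C)
    then show "l \<in> {l. 0 \<le> l \<and> cone_le C (- (l *\<^sub>R e)) x \<and> cone_le C x (l *\<^sub>R e)} \<longleftrightarrow>
        l \<in> {cone_M C x e..}"
      using cone_M_nonneg[OF e_interior x] cone_M_le_iff[OF e_interior, of x l]
      by (auto simp: cone_le_def)
  qed
  then show ?thesis by (simp add: order_unit_norm_def)
qed

lemma unit_slice_nonzero: "y \<in> unit_slice \<Longrightarrow> y \<noteq> 0"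
  using zero_in_C cone_M_le_iff[OF e_interior, of 0 0] by (force simp: unit_slice_def)

lemma compact_unit_slice: "compact unit_slice"
proof -
  have "closed {y. cone_M C y e = 1}"
    by (intro closed_Collect_eq continuous_on_cone_M_compose continuous_intros e_interior)
  then have "closed unit_slice"
    unfolding unit_slice_def by (simp add: closed_C closed_Collect_conj)
  moreover have "unit_slice \<subseteq> cball 0 (norm e)"
  proof
    fix y assume "y \<in> unit_slice"
    then have "y \<in> C" "e - y \<in> C"
      using cone_M_upper[OF e_interior, of y] by (auto simp: unit_slice_def)
    then show "y \<in> cball 0 (norm e)"
      using norm_le_of_order_bounds[of e y] add_C[of e y] interior_in_C[OF e_interior] by simp
  qed
  ultimately show ?thesis
    using compact_eq_bounded_closed bounded_subset[OF bounded_cball] by blast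
qed

text \<open>The radial projection of nonzero cone elements to the unit slice; at \<open>0\<close> it takes the
  value \<open>0\<close>.\<close>

definition slice_proj :: "'a \<Rightarrow> 'a" where
  "slice_proj y = (1 / cone_M C y e) *\<^sub>R y"

lemma slice_proj_in_unit_slice:
  assumes "y \<in> C" "y \<noteq> 0"
  shows "slice_proj y \<in> unit_slice"
  using cone_M_pos[OF e_interior assms] assms
  by (simp add: slice_proj_def unit_slice_def scale_C cone_M_scale_left[OF e_interior])

lemma slice_proj_interior:
  assumes y: "y \<in> interior C"
  shows "slice_proj y \<in> unit_slice \<inter> interior C"
  using slice_proj_in_unit_slice[OF interior_in_C[OF y] interior_nonzero[OF y]]
    cone_M_interior_pos[OF y e_interior] interior_scale[OF y]
  by (simp add: slice_proj_def)

lemma slice_proj_id: "y \<in> unit_slice \<Longrightarrow> slice_proj y = y"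
  by (simp add: slice_proj_def unit_slice_def)

lemma slice_proj_scaleR: "0 < r \<Longrightarrow> slice_proj (r *\<^sub>R y) = slice_proj y"
  by (simp add: slice_proj_def cone_M_scale_left[OF e_interior])

lemma ln_cone_M_slice_proj:
  assumes y: "y \<in> interior C" and x: "x \<in> interior C"
  shows "ln (cone_M C (slice_proj y) x) = ln (cone_M C y x) - ln (cone_M C y e)"
  using cone_M_interior_pos[OF y x] cone_M_interior_pos[OF y e_interior]
  by (simp add: slice_proj_def cone_M_scale_left[OF x] ln_div)

lemma tendsto_slice_proj:
  assumes f: "(f \<longlongrightarrow> y) F" and y: "y \<in> C" "y \<noteq> 0"
  shows "((\<lambda>t. slice_proj (f t)) \<longlongrightarrow> slice_proj y) F"
proof -
  have "continuous_on UNIV (\<lambda>y. cone_M C y e)"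
    by (intro continuous_on_cone_M_compose continuous_intros e_interior)
  then have "((\<lambda>t. cone_M C (f t) e) \<longlongrightarrow> cone_M C y e) F"
    by (rule continuous_on_tendsto_compose[OF _ f]) auto
  then show ?thesis
    unfolding slice_proj_def using cone_M_pos[OF e_interior y] by (intro tendsto_intros f) auto
qed

lemma closure_interior_slice: "closure (unit_slice \<inter> interior C) = unit_slice"
proof
  show "closure (unit_slice \<inter> interior C) \<subseteq> unit_slice"
    by (intro closure_minimal compact_imp_closed compact_unit_slice) auto
  show "unit_slice \<subseteq> closure (unit_slice \<inter> interior C)"
  proof
    fix y assume y: "y \<in> unit_slice"
    then have yC: "y \<in> C" by (simp add: unit_slice_def)
    have lim: "((\<lambda>t. slice_proj (y + t *\<^sub>R e)) \<longlongrightarrow> slice_proj y) (at_right 0)"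
    proof (rule tendsto_slice_proj)
      show "((\<lambda>t. y + t *\<^sub>R e) \<longlongrightarrow> y) (at_right 0)"
        by (rule tendsto_eq_intros refl)+ simp
    qed (use y yC unit_slice_nonzero in auto)
    have *: "slice_proj (y + t *\<^sub>R e) \<in> closure (unit_slice \<inter> interior C)" if "0 < t" for t
      using interior_add[OF interior_scale[OF e_interior that] yC] closure_subset
      by (intro subsetD[OF closure_subset] slice_proj_interior) (simp add: add.commute)
    have "\<forall>\<^sub>F t in at_right 0. slice_proj (y + t *\<^sub>R e) \<in> closure (unit_slice \<inter> interior C)"
      using eventually_at_right_less[of "0::real"] by (rule eventually_mono) (rule *)
    from Lim_in_closed_set[OF closed_closure this _ lim]
    show "y \<in> closure (unit_slice \<inter> interior C)" by (simp add: slice_proj_id y)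
  qed
qed

text \<open>Elements of the cone, possibly on the frontier, are determined by \<open>M(\<cdot>/x)\<close> for interior
  points \<open>x\<close>.\<close>

lemma cone_M_inj:
  assumes y: "y \<in> C" and y': "y' \<in> C"
    and eq: "\<And>x. x \<in> interior C \<Longrightarrow> cone_M C y x = cone_M C y' x"
  shows "y = y'"
proof -
  have le: "u - v \<in> C"
    if u: "u \<in> C" and le: "\<And>x. x \<in> interior C \<Longrightarrow> cone_M C v x \<le> cone_M C u x" for u v
  proof -
    \<comment> \<open>As \<open>u\<close> need not be interior, the hypothesis is used at \<open>u + r e\<close>, and \<open>r\<close> tends to \<open>0\<close>.\<close>
    have *: "u + r *\<^sub>R e - v \<in> C" if r: "0 < r" for r
    proof -
      have x: "u + r *\<^sub>R e \<in> interior C"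
        using interior_add[OF interior_scale[OF e_interior r] u] by (simp add: add.commute)
      have "cone_M C u (u + r *\<^sub>R e) \<le> 1"
        using r e_interior by (simp add: cone_M_le_iff[OF x] scale_C interior_in_C)
      then have "cone_M C v (u + r *\<^sub>R e) \<le> 1" using le[OF x] by linarith
      then show ?thesis by (simp add: cone_M_le_iff[OF x])
    qed
    have "\<forall>\<^sub>F r in at_right 0. u + r *\<^sub>R e - v \<in> C"
      using eventually_at_right_less[of "0::real"] by (rule eventually_mono) (rule *)
    moreover have "((\<lambda>r. u + r *\<^sub>R e - v) \<longlongrightarrow> u + 0 *\<^sub>R e - v) (at_right 0)"
      by (intro tendsto_intros)
    ultimately show ?thesis
      using Lim_in_closed_set[OF closed_C] by fastforce
  qed
  have "y - y' \<in> C" "- (y - y') \<in> C" using le[of y y'] le[of y' y] y y' eq by auto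
  then show ?thesis using pointed by fastforce
qed

lemma cone_M_separates:
  assumes "y \<in> C" "y' \<in> C" "y \<noteq> 0" "y' \<noteq> 0" "y \<noteq> y'"
  shows "\<exists>x\<in>interior C. ln (cone_M C y x) \<noteq> ln (cone_M C y' x)"
proof (rule ccontr)
  assume *: "\<not> ?thesis"
  have "cone_M C y x = cone_M C y' x" if x: "x \<in> interior C" for x
    using * x cone_M_pos[OF x assms(1,3)] cone_M_pos[OF x assms(2,4)] by auto
  then show False using cone_M_inj[of y y'] assms by blast
qed

lemma frontier_C: "frontier C = C - interior C"
  using closed_C by (simp add: frontier_def closure_closed)

lemma slice_frontier_iff:
  "y \<in> unit_slice - interior C \<longleftrightarrow> y \<in> frontier C \<and> order_unit_norm C e y = 1"
  using order_unit_norm_eq_cone_M[of y] by (auto simp: unit_slice_def frontier_C)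

end

section \<open>Interior points and the Jordan inverse\<close>

context euclidean_jordan_algebra
begin

sublocale cone: acute_cone sqcone e
  using closed_cone cone_add cone_scaleR cone_inner e_interior_cone by unfold_locales auto

lemma spectral_sum_in_interior:
  assumes F: "idempotent_resolution F" and l: "\<And>c. c \<in> F \<Longrightarrow> 0 < l c"
  shows "spectral_sum F l \<in> interior sqcone"
proof -
  define r where "r = Min (insert 1 (l ` F))"
  have fin: "finite F" using F by (simp add: idempotent_resolution_def)
  have r: "0 < r" "\<And>c. c \<in> F \<Longrightarrow> r \<le> l c" using fin l by (auto simp: r_def)
  have "spectral_sum F l = r *\<^sub>R e + spectral_sum F (\<lambda>c. l c - r)"
    unfolding spectral_sum_one[OF F, symmetric] by (simp add: spectral_sum_scaleR spectral_sum_add)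
  also have "\<dots> \<in> interior sqcone"
    by (intro cone.interior_add cone.interior_scale e_interior_cone spectral_sum_in_cone F r) (use r in simp)
  finally show ?thesis .
qed

lemma interior_spectral_sum_pos:
  assumes F: "idempotent_resolution F" and int: "spectral_sum F l \<in> interior sqcone"
    and c: "c \<in> F" "c \<noteq> 0"
  shows "0 < l c"
proof -
  obtain r where r: "0 < r" "spectral_sum F l - r *\<^sub>R e \<in> interior sqcone"
    using cone.interior_absorb[OF int] by blast
  have cc: "c \<odot> c = c" using F c by (simp add: idempotent_resolution_def)
  have "0 \<le> (spectral_sum F l - r *\<^sub>R e) \<bullet> c"
    using r cc by (intro cone_inner_idempotent cone.interior_in_C)
  also have "\<dots> = (l c - r) * (c \<bullet> c)"
    using spectral_sum_inner[OF F c(1)] idempotent_inner_self[OF cc]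
    by (simp add: inner_diff_left inner_commute[of e c] left_diff_distrib)
  finally have "0 \<le> (l c - r) * (c \<bullet> c)" .
  moreover have "0 < c \<bullet> c" using c(2) by simp
  ultimately have "0 \<le> l c - r" by (simp add: zero_le_mult_iff)
  then show ?thesis using r by simp
qed

lemma interior_spectral_decomposition:
  assumes "x \<in> interior sqcone"
  obtains F l where "idempotent_resolution F" "0 \<notin> F" "\<forall>c\<in>F. 0 < l c" "x = spectral_sum F l"
    "F \<subseteq> generated_subalgebra (\<odot>) {x, e}"
proof -
  obtain F l where F: "idempotent_resolution F" "0 \<notin> F" "x = spectral_sum F l"
    "F \<subseteq> generated_subalgebra (\<odot>) {x, e}"
    by (rule spectral_decomposition[of x])
  then have "\<forall>c\<in>F. 0 < l c" using interior_spectral_sum_pos assms by metis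
  with F that show ?thesis by blast
qed

abbreviation jinv :: "'a \<Rightarrow> 'a" where "jinv \<equiv> jordan_inverse (\<odot>) e"

lemma generated_subalgebra_subset_spectral_sums:
  assumes F: "idempotent_resolution F"
  shows "generated_subalgebra (\<odot>) {spectral_sum F l, e} \<subseteq> range (spectral_sum F)"
proof (rule generated_subalgebra_minimal)
  show "{spectral_sum F l, e} \<subseteq> range (spectral_sum F)" using spectral_sum_one[OF F] by (metis empty_subsetI insert_subset rangeI)
  show "subspace (range (spectral_sum F))"
    unfolding subspace_def
    by (auto simp: spectral_sum_add spectral_sum_scaleR intro!: image_eqI[where x = "\<lambda>_. 0"]) (simp add: spectral_sum_def)
qed (auto simp: spectral_sum_jprod_spectral_sum[OF F])

text \<open>The given idempotents need not lie in the subalgebra generated by \<open>x\<close> and \<open>e\<close>. Existence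
  of an inverse in that subalgebra comes from another decomposition whose idempotents do, and
  uniqueness holds even in the larger span of the given ones.\<close>

lemma jordan_inverse_spectral_sum:
  assumes F: "idempotent_resolution F" and l: "\<And>c. c \<in> F \<Longrightarrow> 0 < l c"
  shows "jinv (spectral_sum F l) = spectral_sum F (\<lambda>c. 1 / l c)"
proof -
  let ?x = "spectral_sum F l" and ?A = "generated_subalgebra (\<odot>) {spectral_sum F l, e}"
  have uniq: "y = spectral_sum F (\<lambda>c. 1 / l c)" if y: "y \<in> ?A" "?x \<odot> y = e" for y
  proof -
    obtain m where m: "y = spectral_sum F m" using generated_subalgebra_subset_spectral_sums[OF F, of l] y(1) by blast
    have "m c *\<^sub>R c = (1 / l c) *\<^sub>R c" if c: "c \<in> F" for c
    proof -
      have "c = (?x \<odot> y) \<odot> c" using y(2) jprod_unit by simp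
      also have "\<dots> = (l c * m c) *\<^sub>R c" unfolding m spectral_sum_jprod_spectral_sum[OF F] spectral_sum_jprod_idempotent[OF F c] ..
      finally have "(1 / l c) *\<^sub>R c = (1 / l c) *\<^sub>R ((l c * m c) *\<^sub>R c)" by (rule arg_cong)
      then show ?thesis using l[OF c] by auto
    qed
    then show ?thesis unfolding m spectral_sum_def by (rule sum.cong[OF refl])
  qed
  obtain G k where G: "idempotent_resolution G" "0 \<notin> G" "\<forall>c\<in>G. 0 < k c" "?x = spectral_sum G k" "G \<subseteq> ?A"
    by (rule interior_spectral_decomposition[OF spectral_sum_in_interior[OF F l]])
  define z where "z = spectral_sum G (\<lambda>c. 1 / k c)"
  have "z \<in> ?A"
    unfolding z_def spectral_sum_def[of G] using generated_subalgebra_closed G(5)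
    by (intro subspace_sum subspace_mul) auto
  moreover have "?x \<odot> z = e"
  proof -
    have "?x \<odot> z = spectral_sum G (\<lambda>c. k c * (1 / k c))" unfolding G(4) z_def by (rule spectral_sum_jprod_spectral_sum[OF G(1)])
    also have "\<dots> = spectral_sum G (\<lambda>_. 1)" unfolding spectral_sum_def using G(3) by (intro sum.cong) force+
    finally show ?thesis using spectral_sum_one[OF G(1)] by simp
  qed
  ultimately show ?thesis
    unfolding jordan_inverse_def using uniq by (intro the_equality) metis+
qed

lemma jordan_inverse_spectral:
  assumes "x \<in> interior sqcone"
  obtains F l where "idempotent_resolution F" "\<forall>c\<in>F. 0 < l c" "x = spectral_sum F l"
    "jinv x = spectral_sum F (\<lambda>c. 1 / l c)"
proof -
  obtain F l where F: "idempotent_resolution F" "0 \<notin> F" "\<forall>c\<in>F. 0 < l c" "x = spectral_sum F l"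
    "F \<subseteq> generated_subalgebra (\<odot>) {x, e}"
    by (rule interior_spectral_decomposition[OF assms])
  then show ?thesis using that jordan_inverse_spectral_sum[OF F(1), of l] by blast
qed

lemma jordan_inverse_interior:
  assumes "x \<in> interior sqcone"
  shows "jinv x \<in> interior sqcone"
proof -
  obtain F l where F: "idempotent_resolution F" "\<forall>c\<in>F. 0 < l c" "x = spectral_sum F l"
    "jinv x = spectral_sum F (\<lambda>c. 1 / l c)" by (rule jordan_inverse_spectral[OF assms])
  show ?thesis unfolding F(4) using F(2) by (intro spectral_sum_in_interior F(1)) auto
qed

lemma jordan_inverse_involutive:
  assumes "x \<in> interior sqcone"
  shows "jinv (jinv x) = x"
proof -
  obtain F l where F: "idempotent_resolution F" "\<forall>c\<in>F. 0 < l c" "x = spectral_sum F l"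
    "jinv x = spectral_sum F (\<lambda>c. 1 / l c)" by (rule jordan_inverse_spectral[OF assms])
  show ?thesis unfolding F(4) using F(2) jordan_inverse_spectral_sum[OF F(1), of "\<lambda>c. 1 / l c"] F(3) by simp
qed

lemma jprod_jordan_inverse:
  assumes "x \<in> interior sqcone"
  shows "x \<odot> jinv x = e" "quad_rep x (jinv x) = x"
proof -
  obtain F l where F: "idempotent_resolution F" "\<forall>c\<in>F. 0 < l c" "x = spectral_sum F l"
    "jinv x = spectral_sum F (\<lambda>c. 1 / l c)" by (rule jordan_inverse_spectral[OF assms])
  have "x \<odot> jinv x = spectral_sum F (\<lambda>c. l c * (1 / l c))"
    using spectral_sum_jprod_spectral_sum[OF F(1)] F(3,4) by metis
  also have "\<dots> = spectral_sum F (\<lambda>_. 1)" unfolding spectral_sum_def using F(2) by (intro sum.cong) force+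
  finally show 1: "x \<odot> jinv x = e" using spectral_sum_one[OF F(1)] by simp
  have "(x \<odot> x) \<odot> jinv x = spectral_sum F (\<lambda>c. (l c * l c) * (1 / l c))"
    using spectral_sum_jprod_spectral_sum[OF F(1)] F(3,4) by metis
  also have "\<dots> = x" unfolding F(3) spectral_sum_def using F(2) by (intro sum.cong) force+
  finally show "quad_rep x (jinv x) = x" by (simp add: quad_rep_def 1 jprod_unit_right scaleR_2)
qed

lemma jordan_inverse_scaleR:
  assumes "x \<in> interior sqcone" "0 < r"
  shows "jinv (r *\<^sub>R x) = (1 / r) *\<^sub>R jinv x"
proof -
  obtain F l where F: "idempotent_resolution F" "\<forall>c\<in>F. 0 < l c" "x = spectral_sum F l"
    "jinv x = spectral_sum F (\<lambda>c. 1 / l c)" by (rule jordan_inverse_spectral[OF assms(1)])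
  show ?thesis unfolding F(4) unfolding F(3) spectral_sum_scaleR
    using F(2) assms(2) by (subst jordan_inverse_spectral_sum[OF F(1)]) auto
qed

section \<open>Automorphisms of the cone and order reversal\<close>

text \<open>The flow of multiplication by \<open>a\<close>. The last conclusion is the equivariance of the quadratic
  representation: its left hand side solves the differential equation of the flow.\<close>

lemma multiplication_flow:
  obtains T :: "real \<Rightarrow> 'a \<Rightarrow> 'a" where
    "\<And>t. linear (T t)" "\<And>y. T 0 y = y" "\<And>s t y. T s (T t y) = T (s + t) y"
    "\<And>y. continuous_on UNIV (\<lambda>t. T t y)"
    "\<And>Q t. (\<And>s. (Q has_vector_derivative a \<odot> Q s) (at s)) \<Longrightarrow> Q t = T t (Q 0)"
    "\<And>t y z. quad_rep (T t y) (T (- t) z) = T t (quad_rep y z)"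
proof -
  obtain T where T: "\<And>t. linear (T t)" "\<And>y. T 0 y = y"
    "\<And>y t. ((\<lambda>t. T t y) has_vector_derivative a \<odot> T t y) (at t)"
    "\<And>Q t. (\<And>s. (Q has_vector_derivative a \<odot> Q s) (at s)) \<Longrightarrow> Q t = T t (Q 0)"
    using selfadjoint_flow[OF linear_jprod_left jprod_self_adjoint] by blast
  show ?thesis
  proof
    show "T s (T t y) = T (s + t) y" for s t y
    proof -
      have "((\<lambda>s. T (s + t) y) has_vector_derivative a \<odot> T (s + t) y) (at s)" for s
      proof -
        have "((\<lambda>s. T s y) \<circ> (\<lambda>s. s + t) has_vector_derivative 1 *\<^sub>R (a \<odot> T (s + t) y)) (at s)"
          by (rule vector_diff_chain_at) (auto intro!: derivative_eq_intros T(3))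
        then show ?thesis by (simp add: o_def)
      qed
      from T(4)[of "\<lambda>s. T (s + t) y", OF this] show ?thesis by simp
    qed
    show "continuous_on UNIV (\<lambda>t. T t y)" for y
      by (intro continuous_at_imp_continuous_on ballI has_vector_derivative_continuous[OF T(3)])
    show "quad_rep (T t y) (T (- t) z) = T t (quad_rep y z)" for t y z
    proof -
      define u where "u t = T t y" for t
      define v where "v t = T (- t) z" for t
      have u: "(u has_vector_derivative a \<odot> u t) (at t)" for t unfolding u_def by (rule T(3))
      have v: "(v has_vector_derivative - (a \<odot> v t)) (at t)" for t
      proof -
        have "((\<lambda>s. T s z) \<circ> uminus has_vector_derivative (- 1) *\<^sub>R (a \<odot> T (- t) z)) (at t)"
          by (rule vector_diff_chain_at) (auto intro!: derivative_eq_intros T(3))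
        then show ?thesis by (simp add: o_def v_def[abs_def])
      qed
      have expand: "2 *\<^sub>R (u \<odot> (u \<odot> (- q) + p \<odot> v) + p \<odot> (u \<odot> v))
          - ((u \<odot> u) \<odot> (- q) + (u \<odot> p + p \<odot> u) \<odot> v)
          = 2 *\<^sub>R (p \<odot> (u \<odot> v) + u \<odot> (p \<odot> v)) - 2 *\<^sub>R ((u \<odot> p) \<odot> v) - quad_rep u q"
        for u v p q :: 'a
        by (simp add: quad_rep_def jprod_bilin_simps jprod_commute[of p u] scaleR_2)
      note prod = bounded_bilinear.has_vector_derivative[OF bounded_bilinear_jprod]
      have "((\<lambda>t. quad_rep (u t) (v t)) has_vector_derivative a \<odot> quad_rep (u t) (v t)) (at t)" for t
      proof -
        have "((\<lambda>t. quad_rep (u t) (v t)) has_vector_derivative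
          2 *\<^sub>R (u t \<odot> (u t \<odot> (- (a \<odot> v t)) + (a \<odot> u t) \<odot> v t) + (a \<odot> u t) \<odot> (u t \<odot> v t))
          - ((u t \<odot> u t) \<odot> (- (a \<odot> v t)) + (u t \<odot> (a \<odot> u t) + (a \<odot> u t) \<odot> u t) \<odot> v t)) (at t)"
          unfolding quad_rep_def
          by (intro has_vector_derivative_diff prod u v
              bounded_linear.has_vector_derivative[OF bounded_linear_scaleR_right])
        then show ?thesis unfolding expand quad_rep_derivation by simp
      qed
      from T(4)[OF this, of t] show ?thesis by (simp add: u_def v_def T(2))
    qed
  qed (use T in auto)
qed

text \<open>Every interior point is reached from \<open>e\<close> by the flow of its logarithm.\<close>

lemma interior_flow_to:
  assumes x: "x \<in> interior sqcone"
  obtains T :: "real \<Rightarrow> 'a \<Rightarrow> 'a" where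
    "\<And>t. linear (T t)" "\<And>y. T 0 y = y" "\<And>s t y. T s (T t y) = T (s + t) y"
    "\<And>y. continuous_on UNIV (\<lambda>t. T t y)" "T 1 e = x"
    "\<And>t y z. quad_rep (T t y) (T (- t) z) = T t (quad_rep y z)"
proof -
  obtain F l where F: "idempotent_resolution F" "\<forall>c\<in>F. 0 < l c" "x = spectral_sum F l"
    "jinv x = spectral_sum F (\<lambda>c. 1 / l c)" by (rule jordan_inverse_spectral[OF x])
  define a where "a = spectral_sum F (\<lambda>c. ln (l c))"
  obtain T :: "real \<Rightarrow> 'a \<Rightarrow> 'a" where
    T: "\<And>t. linear (T t)" "\<And>y. T 0 y = y" "\<And>s t y. T s (T t y) = T (s + t) y"
    "\<And>y. continuous_on UNIV (\<lambda>t. T t y)"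
    "\<And>Q t. (\<And>s. (Q has_vector_derivative a \<odot> Q s) (at s)) \<Longrightarrow> Q t = T t (Q 0)"
    "\<And>t y z. quad_rep (T t y) (T (- t) z) = T t (quad_rep y z)"
    using multiplication_flow[of a] by blast
  \<comment> \<open>The exponential of \<open>t a\<close>, an explicit solution that starts at \<open>e\<close>.\<close>
  define Q where "Q t = spectral_sum F (\<lambda>c. exp (t * ln (l c)))" for t
  have "(Q has_vector_derivative a \<odot> Q t) (at t)" for t
    unfolding Q_def a_def spectral_sum_jprod_spectral_sum[OF F(1)] unfolding spectral_sum_def
    by (auto intro!: derivative_eq_intros simp: mult_ac)
  from T(5)[of Q 1, OF this] have "T 1 (Q 0) = Q 1" by simp
  moreover have "Q 0 = e" using spectral_sum_one[OF F(1)] by (simp add: Q_def)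
  moreover have "Q 1 = x" unfolding Q_def F(3) spectral_sum_def using F(2) by (intro sum.cong) auto
  ultimately show ?thesis using that T by metis
qed

lemma quad_rep_unit: "quad_rep e w = w"
  by (simp add: quad_rep_def jprod_unit scaleR_2)

text \<open>For \<open>x = T e\<close> the equivariance gives \<open>P(x) = T\<^sup>2\<close>, which is invertible.\<close>

lemma quad_rep_injective:
  assumes x: "x \<in> interior sqcone" and "quad_rep x v = 0"
  shows "v = 0"
proof -
  obtain T :: "real \<Rightarrow> 'a \<Rightarrow> 'a" where
    T: "\<And>t. linear (T t)" "\<And>y. T 0 y = y" "\<And>s t y. T s (T t y) = T (s + t) y"
    "\<And>y. continuous_on UNIV (\<lambda>t. T t y)" "T 1 e = x"
    "\<And>t y z. quad_rep (T t y) (T (- t) z) = T t (quad_rep y z)"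
    using interior_flow_to[OF x] by blast
  have "T 2 v = 0"
    using T(6)[of 1 e "T 1 v"] assms(2) by (simp add: T quad_rep_unit)
  then have "T (- 2) (T 2 v) = 0" by (simp add: linear_0 T(1))
  then show ?thesis by (simp add: T)
qed

text \<open>A frontier point has an eigenvalue zero; its idempotent is a null vector.\<close>

lemma quad_rep_singular_on_frontier:
  assumes y: "y \<in> frontier sqcone"
  obtains v where "v \<noteq> 0" "quad_rep y v = 0"
proof -
  obtain F l where F: "idempotent_resolution F" "0 \<notin> F" "y = spectral_sum F l"
    "F \<subseteq> generated_subalgebra (\<odot>) {y, e}"
    by (rule spectral_decomposition[of y])
  have y': "y \<in> sqcone" "y \<notin> interior sqcone" using y by (auto simp: cone.frontier_C)
  then obtain c where c: "c \<in> F" "\<not> 0 < l c" using spectral_sum_in_interior[OF F(1), of l] F(3) by blast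
  then have "l c = 0" using spectral_sum_in_cone_iff[OF F(1,2), of l] y'(1) F(3) by fastforce
  then have "y \<odot> c = 0" "(y \<odot> y) \<odot> c = 0"
    unfolding F(3) spectral_sum_jprod_spectral_sum[OF F(1)] spectral_sum_jprod_idempotent[OF F(1) c(1)] by simp_all
  then have "quad_rep y c = 0" by (simp add: quad_rep_def jprod_bilin_simps)
  moreover have "c \<noteq> 0" using c F(2) by blast
  ultimately show ?thesis using that by blast
qed

text \<open>The flow maps interior points to interior points by connectedness: on an orbit that starts in the
  interior, the quadratic representation stays injective, so the orbit avoids the frontier.\<close>

lemma interior_automorphism:
  assumes x: "x \<in> interior sqcone"
  obtains T S :: "'a \<Rightarrow> 'a" where "linear T" "linear S" "\<And>y. T (S y) = y" "\<And>y. S (T y) = y" "T e = x"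
    "\<And>y. y \<in> interior sqcone \<Longrightarrow> T y \<in> interior sqcone"
    "\<And>y. y \<in> interior sqcone \<Longrightarrow> S y \<in> interior sqcone"
    "\<And>y z. quad_rep (T y) (S z) = T (quad_rep y z)"
proof -
  obtain T :: "real \<Rightarrow> 'a \<Rightarrow> 'a" where
    T: "\<And>t. linear (T t)" "\<And>y. T 0 y = y" "\<And>s t y. T s (T t y) = T (s + t) y"
    "\<And>y. continuous_on UNIV (\<lambda>t. T t y)" "T 1 e = x"
    "\<And>t y z. quad_rep (T t y) (T (- t) z) = T t (quad_rep y z)"
    using interior_flow_to[OF x] by blast
  have int: "T t y \<in> interior sqcone" if y: "y \<in> interior sqcone" for t y
  proof -
    have nofr: "T s y \<notin> frontier sqcone" for s
    proof
      assume "T s y \<in> frontier sqcone"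
      then obtain v where v: "v \<noteq> 0" "quad_rep (T s y) v = 0" by (rule quad_rep_singular_on_frontier)
      have inv: "T (- s) (T s w) = w" for w by (simp add: T)
      have "T s (quad_rep y (T s v)) = 0" using T(6)[of s y "T s v"] v(2) by (simp add: inv)
      then have "T (- s) (T s (quad_rep y (T s v))) = 0" by (simp add: linear_0 T(1))
      then have "T s v = 0" using quad_rep_injective[OF y] by (simp add: inv)
      then have "T (- s) (T s v) = 0" by (simp add: linear_0 T(1))
      then show False using v(1) by (simp add: inv)
    qed
    have "connected (range (\<lambda>s. T s y))" using T(4) by (intro connected_continuous_image) auto
    moreover have "y \<in> range (\<lambda>s. T s y)" using T(2) by (metis rangeI)
    ultimately have "range (\<lambda>s. T s y) - sqcone = {}"
      using connected_Int_frontier[of "range (\<lambda>s. T s y)" sqcone] nofr y cone.interior_in_C by blast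
    then show ?thesis using nofr[of t] by (auto simp: cone.frontier_C)
  qed
  show ?thesis
    by (rule that[of "T 1" "T (- 1)"]) (use T int in \<open>auto\<close>)
qed

lemma linear_interior_imp_cone:
  assumes T: "linear T" "\<And>y. y \<in> interior sqcone \<Longrightarrow> T y \<in> interior sqcone" and y: "y \<in> sqcone"
  shows "T y \<in> sqcone"
proof -
  have *: "T y + r *\<^sub>R T e \<in> sqcone" if r: "0 < r" for r
  proof -
    have "y + r *\<^sub>R e \<in> interior sqcone"
      using cone.interior_add[OF cone.interior_scale[OF e_interior_cone r] y] by (simp add: add.commute)
    then show ?thesis
      using T(2)[of "y + r *\<^sub>R e"] cone.interior_in_C by (simp add: linear_add linear_scale T(1))
  qed
  have "\<forall>\<^sub>F r in at_right 0. T y + r *\<^sub>R T e \<in> sqcone"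
    using eventually_at_right_less[of "0::real"] by (rule eventually_mono) (rule *)
  moreover have "((\<lambda>r. T y + r *\<^sub>R T e) \<longlongrightarrow> T y + 0 *\<^sub>R T e) (at_right 0)"
    by (intro tendsto_intros)
  ultimately show ?thesis using Lim_in_closed_set[OF closed_cone] by fastforce
qed

text \<open>An automorphism carrying \<open>e\<close> to \<open>x\<close> reduces the claim to \<open>x = e\<close>, where it says that
  eigenvalues at least \<open>1\<close> have reciprocals at most \<open>1\<close>.\<close>

theorem jordan_inverse_antitone:
  assumes x: "x \<in> interior sqcone" and y: "y \<in> interior sqcone" and le: "y - x \<in> sqcone"
  shows "jinv x - jinv y \<in> sqcone"
proof -
  obtain T S where T: "linear T" "linear S" "\<And>y. T (S y) = y" "\<And>y. S (T y) = y" "T e = x"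
    "\<And>y. y \<in> interior sqcone \<Longrightarrow> T y \<in> interior sqcone"
    "\<And>y. y \<in> interior sqcone \<Longrightarrow> S y \<in> interior sqcone"
    "\<And>y z. quad_rep (T y) (S z) = T (quad_rep y z)"
    using interior_automorphism[OF x] by blast
  \<comment> \<open>Both sides solve \<open>P(T w) v = T w\<close>, whose solution is unique.\<close>
  have inv: "jinv (T w) = S (jinv w)" if w: "w \<in> interior sqcone" for w
  proof -
    have "quad_rep (T w) (jinv (T w) - S (jinv w)) = 0"
      using jprod_jordan_inverse(2)[OF w] jprod_jordan_inverse(2)[OF T(6)[OF w]] T(8)[of w "jinv w"]
      by (simp add: linear_diff linear_quad_rep)
    then show ?thesis using quad_rep_injective[OF T(6)[OF w], of "jinv (T w) - S (jinv w)"] by simp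
  qed
  define w where "w = S y"
  have w: "w \<in> interior sqcone" using T(7) y by (simp add: w_def)
  have S_cone: "S v \<in> sqcone" if "v \<in> sqcone" for v
    by (rule linear_interior_imp_cone[OF T(2,7) that])
  have "S (y - x) \<in> sqcone" by (rule S_cone[OF le])
  then have we: "w - e \<in> sqcone" using T(4)[of e] T(5) by (simp add: w_def linear_diff T(2))
  obtain F l where F: "idempotent_resolution F" "0 \<notin> F" "\<forall>c\<in>F. 0 < l c" "w = spectral_sum F l"
    "F \<subseteq> generated_subalgebra (\<odot>) {w, e}"
    by (rule interior_spectral_decomposition[OF w])
  have "spectral_sum F (\<lambda>c. l c - 1) \<in> sqcone"
    using we F(4) spectral_sum_one[OF F(1)] spectral_sum_diff[of F l "\<lambda>_. 1"] by simp
  then have "\<forall>c\<in>F. 1 \<le> l c" using spectral_sum_in_cone_iff[OF F(1,2)] by auto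
  then have "spectral_sum F (\<lambda>c. 1 - 1 / l c) \<in> sqcone" by (intro spectral_sum_in_cone F(1)) auto
  then have "e - jinv w \<in> sqcone"
    using jordan_inverse_spectral_sum[OF F(1), of l] F(3,4) spectral_sum_one[OF F(1)]
      spectral_sum_diff[of F "\<lambda>_. 1" "\<lambda>c. 1 / l c"] by simp
  then have "S (e - jinv w) \<in> sqcone" by (rule S_cone)
  moreover have "jinv e = e"
    using jprod_jordan_inverse(1)[OF e_interior_cone] by (simp add: jprod_unit)
  then have "jinv x = S e" using inv[OF e_interior_cone] T(5) by simp
  moreover have "jinv y = S (jinv w)" using inv[OF w] T(3) by (simp add: w_def)
  ultimately show ?thesis by (simp add: linear_diff T(2))
qed

lemma cone_M_jordan_inverse:
  assumes x: "x \<in> interior sqcone" and y: "y \<in> interior sqcone"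
  shows "cone_M sqcone (jinv y) (jinv x) = cone_M sqcone x y"
proof -
  have le: "cone_M sqcone (jinv y) (jinv x) \<le> cone_M sqcone x y"
    if x: "x \<in> interior sqcone" and y: "y \<in> interior sqcone" for x y
  proof -
    let ?m = "cone_M sqcone x y"
    have m: "0 < ?m" by (rule cone.cone_M_interior_pos[OF x y])
    have "jinv x - jinv (?m *\<^sub>R y) \<in> sqcone"
      by (intro jordan_inverse_antitone cone.cone_M_upper cone.interior_scale x y m)
    then have "?m *\<^sub>R (jinv x - (1 / ?m) *\<^sub>R jinv y) \<in> sqcone"
      using m by (intro cone_scaleR) (simp_all add: jordan_inverse_scaleR[OF y m])
    then show ?thesis
      using m by (simp add: cone.cone_M_le_iff jordan_inverse_interior x scaleR_diff_right)
  qed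
  show ?thesis
    using le[OF x y] le[OF jordan_inverse_interior[OF y] jordan_inverse_interior[OF x]]
    by (simp add: jordan_inverse_involutive x y)
qed

text \<open>Continuity is inherited from \<open>M\<close>: as \<open>y\<close> tends to \<open>x\<close>, the two ratios of \<open>x\<close> and \<open>y\<close>, hence
  also those of their inverses, tend to \<open>1\<close>.\<close>

lemma continuous_on_jordan_inverse: "continuous_on (interior sqcone) jinv"
  unfolding continuous_on_def
proof
  fix x assume x: "x \<in> interior sqcone"
  let ?F = "at x within interior sqcone"
  let ?a = "\<lambda>y. cone_M sqcone x y" and ?b = "\<lambda>y. cone_M sqcone y x"
  define s where "s y = \<bar>?a y - 1\<bar> + \<bar>1 - 1 / ?b y\<bar>" for y
  have "continuous_on (interior sqcone) ?a" "continuous_on (interior sqcone) ?b"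
    using x by (intro cone.continuous_on_cone_M_compose continuous_intros; simp)+
  then have "(?a \<longlongrightarrow> 1) ?F" "(?b \<longlongrightarrow> 1) ?F"
    using x cone.cone_M_self[OF x] by (auto simp: continuous_on_def)
  then have "(s \<longlongrightarrow> \<bar>1 - 1\<bar> + \<bar>1 - 1 / 1\<bar>) ?F"
    unfolding s_def by (intro tendsto_intros) auto
  then have lim: "((\<lambda>y. s y * norm (jinv x)) \<longlongrightarrow> 0) ?F"
    using tendsto_mult_left_zero by fastforce
  have bound: "norm (jinv y - jinv x) \<le> s y * norm (jinv x)" if y: "y \<in> interior sqcone" for y
  proof -
    have pos: "0 < ?b y" by (rule cone.cone_M_interior_pos[OF y x])
    have 1: "?a y *\<^sub>R jinv x - jinv y \<in> sqcone"
      using cone.cone_M_upper[of "jinv x" "jinv y"] cone_M_jordan_inverse[OF x y]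
      by (simp add: jordan_inverse_interior x)
    have 2: "?b y *\<^sub>R jinv y - jinv x \<in> sqcone"
      using cone.cone_M_upper[of "jinv y" "jinv x"] cone_M_jordan_inverse[OF y x]
      by (simp add: jordan_inverse_interior y)
    have jx: "jinv x \<in> sqcone" by (intro cone.interior_in_C jordan_inverse_interior x)
    have "(?a y *\<^sub>R jinv x - jinv y) + (s y + 1 - ?a y) *\<^sub>R jinv x \<in> sqcone"
      by (intro cone_add 1 cone_scaleR jx) (simp add: s_def)
    then have 3: "s y *\<^sub>R jinv x - (jinv y - jinv x) \<in> sqcone" by (simp add: algebra_simps)
    have "(1 / ?b y) *\<^sub>R (?b y *\<^sub>R jinv y - jinv x) + (s y - (1 - 1 / ?b y)) *\<^sub>R jinv x \<in> sqcone"
      using pos by (intro cone_add cone_scaleR 2 jx) (auto simp: s_def)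
    moreover have "(1 / ?b y) *\<^sub>R (?b y *\<^sub>R jinv y - jinv x) + (s y - (1 - 1 / ?b y)) *\<^sub>R jinv x
        = s y *\<^sub>R jinv x + (jinv y - jinv x)"
      using pos by (simp add: scaleR_diff_right scaleR_diff_left)
    ultimately have "s y *\<^sub>R jinv x + (jinv y - jinv x) \<in> sqcone" by simp
    from cone.norm_le_of_order_bounds[OF 3 this]
    show ?thesis by (simp add: s_def)
  qed
  have "((\<lambda>y. jinv y - jinv x) \<longlongrightarrow> 0) ?F"
    by (rule Lim_null_comparison[OF _ lim]) (auto simp: eventually_at_filter bound)
  then show "(jinv \<longlongrightarrow> jinv x) ?F" by (simp add: LIM_zero_iff)
qed

end

section \<open>Closures of parametrised families of functions\<close>

lemma openin_compact_unif_eval: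
  assumes x: "x \<in> topspace T" and V: "open V"
  shows "openin (compact_unif_topology T) {h \<in> cont_funs T. h x \<in> V}"
  unfolding openin_compact_unif_topology
proof (intro conjI ballI)
  fix f assume "f \<in> {h \<in> cont_funs T. h x \<in> V}"
  then obtain r where r: "0 < r" "\<And>v. dist v (f x) < r \<Longrightarrow> v \<in> V"
    using V unfolding open_dist by blast
  have "compactin T {x}" using x by (simp add: finite_imp_compactin)
  then show "\<exists>K \<epsilon>. compactin T K \<and> 0 < \<epsilon> \<and>
      {g \<in> cont_funs T. \<forall>x\<in>K. \<bar>g x - f x\<bar> < \<epsilon>} \<subseteq> {h \<in> cont_funs T. h x \<in> V}"
    using r by (intro exI[of _ "{x}"] exI[of _ r]) (auto simp: dist_real_def)
qed auto

lemma Hausdorff_compact_unif_topology: "Hausdorff_space (compact_unif_topology T)"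
  unfolding Hausdorff_space_def topspace_compact_unif_topology
proof (intro allI impI, elim conjE)
  fix f g assume f: "f \<in> cont_funs T" and g: "g \<in> cont_funs T" and "f \<noteq> g"
  then obtain x where x: "x \<in> topspace T" "f x \<noteq> g x"
    by (metis (no_types, lifting) cont_funs_def extensionalityI mem_Collect_eq)
  then obtain U V where UV: "open U" "open V" "f x \<in> U" "g x \<in> V" "U \<inter> V = {}"
    using hausdorff by metis
  show "\<exists>U V. openin (compact_unif_topology T) U \<and> openin (compact_unif_topology T) V \<and>
      f \<in> U \<and> g \<in> V \<and> disjnt U V"
    using openin_compact_unif_eval[OF x(1) UV(1)] openin_compact_unif_eval[OF x(1) UV(2)] UV f g
    by (intro exI[of _ "{h \<in> cont_funs T. h x \<in> U}"] exI[of _ "{h \<in> cont_funs T. h x \<in> V}"])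
      (auto simp: disjnt_def)
qed

lemma continuous_map_compact_unif_topology:
  fixes \<Phi> :: "'b::metric_space \<Rightarrow> 'a::metric_space \<Rightarrow> real"
  assumes K: "compact K" and cont: "continuous_on (K \<times> M) (\<lambda>p. \<Phi> (fst p) (snd p))"
  shows "continuous_map (top_of_set K) (compact_unif_topology (top_of_set M))
           (\<lambda>s. restrict (\<Phi> s) M)"
proof -
  let ?T = "top_of_set M"
  have mem: "restrict (\<Phi> s) M \<in> cont_funs ?T" if "s \<in> K" for s
  proof -
    have "continuous_on M (\<lambda>x. \<Phi> (fst (s, x)) (snd (s, x)))"
      by (rule continuous_on_compose2[OF cont]) (use that in \<open>auto intro!: continuous_intros\<close>)
    then show ?thesis
      by (auto simp: cont_funs_def cong: continuous_on_cong)
  qed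
  show ?thesis
    unfolding continuous_map_def topspace_compact_unif_topology
  proof (intro conjI allI impI)
    show "(\<lambda>s. restrict (\<Phi> s) M) \<in> topspace (top_of_set K) \<rightarrow> cont_funs ?T" using mem by auto
    fix U assume U: "openin (compact_unif_topology ?T) U"
    show "openin (top_of_set K) {s \<in> topspace (top_of_set K). restrict (\<Phi> s) M \<in> U}"
      unfolding openin_euclidean_subtopology_iff
    proof (intro conjI ballI)
      fix s assume "s \<in> {s \<in> topspace (top_of_set K). restrict (\<Phi> s) M \<in> U}"
      then have s: "s \<in> K" "restrict (\<Phi> s) M \<in> U" by auto
      obtain Q r where Q: "compactin ?T Q" "0 < r"
        "{g \<in> cont_funs ?T. \<forall>x\<in>Q. \<bar>g x - restrict (\<Phi> s) M x\<bar> < r} \<subseteq> U"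
        using U s(2) unfolding openin_compact_unif_topology by blast
      have QM: "compact Q" "Q \<subseteq> M" using Q(1) by (auto simp: compactin_subtopology)
      have "uniformly_continuous_on (K \<times> Q) (\<lambda>p. \<Phi> (fst p) (snd p))"
        using QM K by (intro compact_uniformly_continuous continuous_on_subset[OF cont] compact_Times) auto
      then obtain d where d: "0 < d" "\<And>p q. p \<in> K \<times> Q \<Longrightarrow> q \<in> K \<times> Q \<Longrightarrow> dist q p < d \<Longrightarrow>
          dist (\<Phi> (fst q) (snd q)) (\<Phi> (fst p) (snd p)) < r"
        using Q(2) unfolding uniformly_continuous_on_def by metis
      show "\<exists>d>0. \<forall>s'\<in>K. dist s' s < d \<longrightarrow>
          s' \<in> {s \<in> topspace (top_of_set K). restrict (\<Phi> s) M \<in> U}"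
      proof (intro exI[of _ d] conjI ballI impI)
        fix s' assume s': "s' \<in> K" "dist s' s < d"
        have "\<bar>restrict (\<Phi> s') M x - restrict (\<Phi> s) M x\<bar> < r" if "x \<in> Q" for x
          using d(2)[of "(s, x)" "(s', x)"] s s' that QM(2)
          by (auto simp: dist_Pair_Pair dist_real_def subsetD)
        then have "restrict (\<Phi> s') M \<in> U" using Q(3) mem[OF s'(1)] by blast
        then show "s' \<in> {s \<in> topspace (top_of_set K). restrict (\<Phi> s) M \<in> U}" using s'(1) by simp
      qed (rule d(1))
    qed auto
  qed
qed

text \<open>The image of \<open>K\<close> is compact in a Hausdorff space, hence closed, and the image of \<open>D\<close> is dense in it.\<close>

lemma closure_of_compact_parametrization:
  fixes \<Phi> :: "'b::metric_space \<Rightarrow> 'a::metric_space \<Rightarrow> real"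
  assumes K: "compact K" "closure D = K"
    and cont: "continuous_on (K \<times> M) (\<lambda>p. \<Phi> (fst p) (snd p))"
  shows "compact_unif_topology (top_of_set M) closure_of ((\<lambda>s. restrict (\<Phi> s) M) ` D) =
           (\<lambda>s. restrict (\<Phi> s) M) ` K" (is "?Y closure_of (?F ` D) = _")
proof
  have map: "continuous_map (top_of_set K) ?Y ?F"
    by (rule continuous_map_compact_unif_topology[OF K(1) cont])
  have "compactin ?Y (?F ` K)"
    by (rule image_compactin[OF _ map]) (use K(1) in \<open>simp add: compactin_subtopology\<close>)
  then have "closedin ?Y (?F ` K)"
    by (rule compactin_imp_closedin[OF Hausdorff_compact_unif_topology])
  then show "?Y closure_of (?F ` D) \<subseteq> ?F ` K"
    using K(2) closure_subset by (intro closure_of_minimal image_mono) auto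
  have "(top_of_set K) closure_of D = K"
    using K(2) closure_subset[of D] by (simp add: closure_of_subtopology Int_absorb1)
  then show "?F ` K \<subseteq> ?Y closure_of (?F ` D)"
    using continuous_map_image_closure_subset[OF map, of D] by simp
qed

text \<open>If the normalised distance functions form a family indexed by a set \<open>D\<close>, and the family extends
  continuously to the compact closure \<open>K\<close> without repeating on \<open>K - D\<close> a function indexed by \<open>D\<close>,
  then the horofunctions are those indexed by \<open>K - D\<close>.\<close>

lemma horofunction_boundary_parametrization:
  fixes \<Phi> :: "'b::metric_space \<Rightarrow> 'a::euclidean_space \<Rightarrow> real"
  assumes T: "thompson_topology C = top_of_set (interior C)"
    and K: "compact K" "closure D = K"
    and cont: "continuous_on (K \<times> interior C) (\<lambda>p. \<Phi> (fst p) (snd p))"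
    and img: "horo_map C b \<rho> ` interior C = (\<lambda>s. restrict (\<Phi> s) (interior C)) ` D"
    and new: "\<And>s s'. s \<in> K - D \<Longrightarrow> s' \<in> D \<Longrightarrow> \<exists>x\<in>interior C. \<Phi> s x \<noteq> \<Phi> s' x"
  shows "horofunction_boundary C b \<rho> =
    {f \<in> cont_funs (thompson_topology C). \<exists>s\<in>K - D. \<forall>x\<in>interior C. f x = \<Phi> s x}"
proof -
  let ?F = "\<lambda>s. restrict (\<Phi> s) (interior C)"
  have "horofunction_boundary C b \<rho> = ?F ` K - ?F ` D"
    unfolding horofunction_boundary_def img T closure_of_compact_parametrization[OF K cont] ..
  also have "\<dots> = ?F ` (K - D)"
  proof -
    have "?F s \<notin> ?F ` D" if s: "s \<in> K - D" for s
    proof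
      assume "?F s \<in> ?F ` D"
      then obtain s' where s': "s' \<in> D" "?F s = ?F s'" by (elim imageE)
      obtain x where "x \<in> interior C" "\<Phi> s x \<noteq> \<Phi> s' x" using new[OF s s'(1)] by (elim bexE)
      then show False using fun_cong[OF s'(2), of x] by simp
    qed
    then show ?thesis by (intro equalityI subsetI) (elim DiffE imageE, simp, auto)
  qed
  also have "\<dots> = {f \<in> cont_funs (thompson_topology C). \<exists>s\<in>K - D. \<forall>x\<in>interior C. f x = \<Phi> s x}"
  proof (intro equalityI subsetI)
    fix f assume "f \<in> ?F ` (K - D)"
    then show "f \<in> {f \<in> cont_funs (thompson_topology C). \<exists>s\<in>K - D. \<forall>x\<in>interior C. f x = \<Phi> s x}"
      using continuous_map_compact_unif_topology[OF K(1) cont]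
      by (auto simp: T continuous_map_def)
  next
    fix f assume "f \<in> {f \<in> cont_funs (thompson_topology C). \<exists>s\<in>K - D. \<forall>x\<in>interior C. f x = \<Phi> s x}"
    then obtain s where f: "f \<in> cont_funs (thompson_topology C)" and s: "s \<in> K - D"
      "\<forall>x\<in>interior C. f x = \<Phi> s x" by blast
    have "f \<in> extensional (interior C)" using f by (auto simp: T cont_funs_def)
    then have "f = ?F s" using s(2) by (intro extensionalityI[of _ "interior C"]) auto
    then show "f \<in> ?F ` (K - D)" using s(1) by blast
  qed
  finally show ?thesis .
qed

section \<open>The Funk and reverse Funk horofunctions\<close>

context acute_cone
begin

lemma horofunction_boundary_rfunk:
  "horofunction_boundary C e (rfunk C) =
    {g \<in> cont_funs (thompson_topology C). \<exists>y\<in>frontier C. order_unit_norm C e y = 1 \<and>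
       (\<forall>x\<in>interior C. g x = rfunk C x y)}"
proof -
  have cont: "continuous_on (unit_slice \<times> interior C) (\<lambda>p. rfunk C (snd p) (fst p))"
    unfolding rfunk_def
    using cone_M_pos unit_slice_nonzero
    by (intro continuous_on_ln continuous_on_cone_M_compose continuous_intros)
      (force simp: unit_slice_def)+
  have map: "horo_map C e (rfunk C) y = restrict (\<lambda>x. rfunk C x (slice_proj y)) (interior C)"
    if "y \<in> interior C" for y
    using that by (auto simp: horo_map_def rfunk_def ln_cone_M_slice_proj)
  have img: "horo_map C e (rfunk C) ` interior C =
      (\<lambda>y. restrict (\<lambda>x. rfunk C x y) (interior C)) ` (unit_slice \<inter> interior C)"
  proof -
    have "y \<in> slice_proj ` interior C" if "y \<in> unit_slice \<inter> interior C" for y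
      using that slice_proj_id[of y] by (metis IntD1 IntD2 image_eqI)
    then have set: "slice_proj ` interior C = unit_slice \<inter> interior C"
      using slice_proj_interior by blast
    have "horo_map C e (rfunk C) ` interior C =
        (\<lambda>y. restrict (\<lambda>x. rfunk C x (slice_proj y)) (interior C)) ` interior C"
      by (rule image_cong[OF refl map])
    also have "\<dots> = (\<lambda>y. restrict (\<lambda>x. rfunk C x y) (interior C)) ` slice_proj ` interior C"
      by (simp only: image_image)
    finally show ?thesis unfolding set .
  qed
  have "\<exists>x\<in>interior C. rfunk C x y \<noteq> rfunk C x y'"
    if "y \<in> unit_slice - (unit_slice \<inter> interior C)" "y' \<in> unit_slice \<inter> interior C" for y y'
    unfolding rfunk_def using that unit_slice_nonzero
    by (intro cone_M_separates) (auto simp: unit_slice_def)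
  from horofunction_boundary_parametrization[where \<Phi> = "\<lambda>y x. rfunk C x y",
      OF thompson_topology_eq compact_unit_slice closure_interior_slice cont img this]
  show ?thesis
    unfolding Diff_Int2[symmetric] using slice_frontier_iff by auto
qed

end

context euclidean_jordan_algebra
begin

abbreviation "slice \<equiv> cone.unit_slice"
abbreviation "proj \<equiv> cone.slice_proj"

lemma funk_eq_rfunk_jordan_inverse:
  "x \<in> interior sqcone \<Longrightarrow> y \<in> interior sqcone \<Longrightarrow> funk sqcone x y = rfunk sqcone (jinv x) (jinv y)"
  by (simp add: funk_def rfunk_def cone_M_jordan_inverse)

lemma jordan_inverse_unit: "jinv e = e"
  using jprod_jordan_inverse(1)[OF e_interior_cone] by (simp add: jprod_unit)

lemma horofunction_boundary_funk:
  "horofunction_boundary sqcone e (funk sqcone) =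
    {f \<in> cont_funs (thompson_topology sqcone). \<exists>z\<in>frontier sqcone. order_unit_norm sqcone e z = 1 \<and>
       (\<forall>x\<in>interior sqcone. f x = rfunk sqcone (jinv x) z)}"
proof -
  let ?C = sqcone
  have inv: "jinv x \<in> interior ?C" if "x \<in> interior ?C" for x using that by (rule jordan_inverse_interior)
  have cont: "continuous_on (slice \<times> interior ?C) (\<lambda>p. rfunk ?C (jinv (snd p)) (fst p))"
    unfolding rfunk_def
    using cone.cone_M_pos cone.unit_slice_nonzero inv
    by (intro continuous_on_ln cone.continuous_on_cone_M_compose continuous_intros
        continuous_on_compose2[OF continuous_on_jordan_inverse])
      (force simp: cone.unit_slice_def)+
  have map: "horo_map ?C e (funk ?C) y = restrict (\<lambda>x. rfunk ?C (jinv x) (proj (jinv y))) (interior ?C)"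
    if "y \<in> interior ?C" for y
    unfolding horo_map_def using that inv e_interior_cone
    by (intro restrict_ext)
      (simp add: funk_eq_rfunk_jordan_inverse jordan_inverse_unit rfunk_def cone.ln_cone_M_slice_proj)
  have img: "horo_map ?C e (funk ?C) ` interior ?C =
      (\<lambda>y. restrict (\<lambda>x. rfunk ?C (jinv x) y) (interior ?C)) ` (slice \<inter> interior ?C)"
  proof -
    have "y \<in> (\<lambda>y. proj (jinv y)) ` interior ?C" if "y \<in> slice \<inter> interior ?C" for y
      using that inv by (auto intro!: image_eqI[of _ _ "jinv y"]
        simp: cone.slice_proj_id jordan_inverse_involutive)
    then have set: "(\<lambda>y. proj (jinv y)) ` interior ?C = slice \<inter> interior ?C"
      using inv cone.slice_proj_interior by blast
    have "horo_map ?C e (funk ?C) ` interior ?C =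
        (\<lambda>y. restrict (\<lambda>x. rfunk ?C (jinv x) (proj (jinv y))) (interior ?C)) ` interior ?C"
      by (rule image_cong[OF refl map])
    also have "\<dots> = (\<lambda>y. restrict (\<lambda>x. rfunk ?C (jinv x) y) (interior ?C)) ` (\<lambda>y. proj (jinv y)) ` interior ?C"
      by (simp only: image_image)
    finally show ?thesis unfolding set .
  qed
  have "\<exists>x\<in>interior ?C. rfunk ?C (jinv x) y \<noteq> rfunk ?C (jinv x) y'"
    if y: "y \<in> slice - (slice \<inter> interior ?C)" "y' \<in> slice \<inter> interior ?C" for y y'
  proof -
    have "\<exists>x\<in>interior ?C. rfunk ?C x y \<noteq> rfunk ?C x y'"
      unfolding rfunk_def using y cone.unit_slice_nonzero
      by (intro cone.cone_M_separates) (auto simp: cone.unit_slice_def)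
    then show ?thesis using inv jordan_inverse_involutive by metis
  qed
  from horofunction_boundary_parametrization[where \<Phi> = "\<lambda>y x. rfunk ?C (jinv x) y",
      OF cone.thompson_topology_eq cone.compact_unit_slice cone.closure_interior_slice cont img this]
  show ?thesis
    unfolding Diff_Int2[symmetric] using cone.slice_frontier_iff by auto
qed

section \<open>The Hilbert horofunctions\<close>

lemma cone_sum:
  assumes "\<And>c. c \<in> A \<Longrightarrow> f c \<in> sqcone"
  shows "sum f A \<in> sqcone"
  using assms by (induction A rule: infinite_finite_induct) (auto intro: cone.zero_in_C cone_add)

text \<open>Spectral decompositions of \<open>y\<close> and \<open>z\<close> with positive eigenvalues \<open>l\<close> on \<open>A\<close> and \<open>m\<close> on \<open>B\<close> combine to
  one resolution of the unit, because \<open>y \<odot> z = 0\<close> makes \<open>A\<close> and \<open>B\<close> orthogonal. The curve has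
  eigenvalues \<open>l\<close> on \<open>A\<close>, \<open>t\<^sup>2 / m\<close> on \<open>B\<close> and \<open>t\<close> on the remaining idempotent \<open>r\<close>, so that \<open>t\<^sup>2\<close>
  times its inverse tends to \<open>z\<close> as \<open>t\<close> tends to \<open>0\<close>.\<close>

lemma complementary_curve:
  assumes y: "y \<in> sqcone" and z: "z \<in> sqcone" and yz: "y \<odot> z = 0"
  obtains u v r where "u \<in> sqcone" "v \<in> sqcone" "r \<in> sqcone"
    "\<And>t. 0 < t \<Longrightarrow> y + t^2 *\<^sub>R u + t *\<^sub>R r \<in> interior sqcone"
    "\<And>t. 0 < t \<Longrightarrow> jinv (y + t^2 *\<^sub>R u + t *\<^sub>R r) = v + (1 / t^2) *\<^sub>R z + (1 / t) *\<^sub>R r"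
proof -
  obtain F l where F: "idempotent_resolution F" "0 \<notin> F" "y = spectral_sum F l"
    "F \<subseteq> generated_subalgebra (\<odot>) {y, e}" by (rule spectral_decomposition[of y])
  obtain G m where G: "idempotent_resolution G" "0 \<notin> G" "z = spectral_sum G m"
    "G \<subseteq> generated_subalgebra (\<odot>) {z, e}" by (rule spectral_decomposition[of z])
  have l: "\<And>c. c \<in> F \<Longrightarrow> 0 \<le> l c" using y spectral_sum_in_cone_iff[OF F(1,2)] F(3) by simp
  have m: "\<And>c. c \<in> G \<Longrightarrow> 0 \<le> m c" using z spectral_sum_in_cone_iff[OF G(1,2)] G(3) by simp
  define A where "A = {c \<in> F. 0 < l c}"
  define B where "B = {c \<in> G. 0 < m c}"
  have fin: "finite F" "finite G" "finite A" "finite B"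
    using F(1) G(1) by (auto simp: idempotent_resolution_def A_def B_def)
  have yA: "y = (\<Sum>c\<in>A. l c *\<^sub>R c)"
    unfolding F(3) spectral_sum_def A_def using l fin by (intro sum.mono_neutral_right) force+
  have zB: "z = (\<Sum>c\<in>B. m c *\<^sub>R c)"
    unfolding G(3) spectral_sum_def B_def using m fin by (intro sum.mono_neutral_right) force+
  have idA: "\<And>c. c \<in> A \<Longrightarrow> c \<odot> c = c" and idB: "\<And>c. c \<in> B \<Longrightarrow> c \<odot> c = c"
    using F(1) G(1) by (auto simp: A_def B_def idempotent_resolution_def)
  have orthA: "\<And>c d. c \<in> A \<Longrightarrow> d \<in> A \<Longrightarrow> c \<noteq> d \<Longrightarrow> c \<odot> d = 0"
    and orthB: "\<And>c d. c \<in> B \<Longrightarrow> d \<in> B \<Longrightarrow> c \<noteq> d \<Longrightarrow> c \<odot> d = 0"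
    using F(1) G(1) by (auto simp: A_def B_def idempotent_resolution_def)
  have AB: "c \<odot> d = 0" if c: "c \<in> A" and d: "d \<in> B" for c d
  proof -
    have "(\<Sum>c\<in>A. l c * (c \<bullet> z)) = 0"
      using inner_jprod_e[of y z] yz by (simp add: yA inner_sum_left)
    moreover have "\<And>c. c \<in> A \<Longrightarrow> 0 \<le> l c * (c \<bullet> z)"
      using z idA by (auto simp: A_def intro!: mult_nonneg_nonneg cone_inner idempotent_in_cone)
    ultimately have "l c * (c \<bullet> z) = 0" using fin c by (simp add: sum_nonneg_eq_0_iff)
    then have "c \<bullet> z = 0" using c by (simp add: A_def)
    then have "(\<Sum>d\<in>B. m d * (c \<bullet> d)) = 0" by (simp add: zB inner_sum_right)
    moreover have "\<And>d. d \<in> B \<Longrightarrow> 0 \<le> m d * (c \<bullet> d)"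
      using idA[OF c] idB by (auto simp: B_def intro!: mult_nonneg_nonneg cone_inner idempotent_in_cone)
    ultimately have "m d * (c \<bullet> d) = 0" using fin d by (simp add: sum_nonneg_eq_0_iff)
    then have "c \<bullet> d = 0" using d by (simp add: B_def)
    then show ?thesis by (rule idempotents_orthogonal[OF idA[OF c] idB[OF d]])
  qed
  have BA: "d \<odot> c = 0" if "c \<in> A" "d \<in> B" for c d using AB[OF that] jprod_commute by simp
  have nz: "0 \<notin> A" "0 \<notin> B" using F(2) G(2) by (auto simp: A_def B_def)
  have disj: "A \<inter> B = {}" using AB idA nz by fastforce
  define r where "r = e - (\<Sum>A + \<Sum>B)"
  have rA: "c \<odot> r = 0" if c: "c \<in> A" for c
  proof -
    have "c \<odot> \<Sum>A = (\<Sum>d\<in>A. if d = c then c else 0)"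
      unfolding linear_sum[OF linear_jprod_left] using orthA idA c by (intro sum.cong) auto
    moreover have "c \<odot> \<Sum>B = 0"
      unfolding linear_sum[OF linear_jprod_left] using AB c by (intro sum.neutral) auto
    ultimately show ?thesis using c fin by (simp add: r_def jprod_bilin_simps jprod_unit_right)
  qed
  have rB: "c \<odot> r = 0" if c: "c \<in> B" for c
  proof -
    have "c \<odot> \<Sum>B = (\<Sum>d\<in>B. if d = c then c else 0)"
      unfolding linear_sum[OF linear_jprod_left] using orthB idB c by (intro sum.cong) auto
    moreover have "c \<odot> \<Sum>A = 0"
      unfolding linear_sum[OF linear_jprod_left] using BA c by (intro sum.neutral) auto
    ultimately show ?thesis using c fin by (simp add: r_def jprod_bilin_simps jprod_unit_right)
  qed
  have rr: "r \<odot> r = r"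
  proof -
    have "r \<odot> \<Sum>A = 0" "r \<odot> \<Sum>B = 0"
      unfolding linear_sum[OF linear_jprod_left] using rA rB
      by (auto intro!: sum.neutral simp: jprod_commute[of r])
    then show ?thesis
      using jprod_unit_right[of r] by (simp add: r_def[THEN arg_cong[where f = "(\<odot>) r"]] jprod_bilin_simps)
  qed
  have rnot: "r \<notin> A \<union> B" using rA rB idA idB nz by fastforce
  define H where "H = insert r (A \<union> B)"
  have sumH: "(\<Sum>c\<in>H. f c) = (\<Sum>c\<in>A. f c) + (\<Sum>c\<in>B. f c) + f r" for f :: "'a \<Rightarrow> 'a"
    unfolding H_def using fin rnot disj by (simp add: sum.union_disjoint)
  have H: "idempotent_resolution H"
    unfolding idempotent_resolution_def
  proof (intro conjI ballI impI)
    show "\<Sum>H = e" unfolding sumH by (simp add: r_def)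
    show "c \<odot> d = 0" if "c \<in> H" "d \<in> H" "c \<noteq> d" for c d
      using that orthA orthB AB BA rA rB jprod_commute[of r d] by (auto simp: H_def)
  qed (use fin idA idB rr in \<open>auto simp: H_def\<close>)
  define u where "u = (\<Sum>c\<in>B. (1 / m c) *\<^sub>R c)"
  define v where "v = (\<Sum>c\<in>A. (1 / l c) *\<^sub>R c)"
  define k where "k t c = (if c \<in> A then l c else if c \<in> B then t^2 / m c else t)" for t c
  have kpos: "0 < k t c" if "0 < t" for t c using that by (simp add: k_def A_def B_def)
  have curve: "spectral_sum H (k t) = y + t^2 *\<^sub>R u + t *\<^sub>R r" for t
  proof -
    have "(\<Sum>c\<in>A. k t c *\<^sub>R c) = y" unfolding yA by (intro sum.cong) (auto simp: k_def)
    moreover have "(\<Sum>c\<in>B. k t c *\<^sub>R c) = t^2 *\<^sub>R u"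
      unfolding u_def scaleR_sum_right using disj by (intro sum.cong) (auto simp: k_def)
    moreover have "k t r = t" using rnot by (simp add: k_def)
    ultimately show ?thesis unfolding spectral_sum_def sumH by simp
  qed
  have curve': "spectral_sum H (\<lambda>c. 1 / k t c) = v + (1 / t^2) *\<^sub>R z + (1 / t) *\<^sub>R r" for t
  proof -
    have "(\<Sum>c\<in>A. (1 / k t c) *\<^sub>R c) = v" unfolding v_def by (intro sum.cong) (auto simp: k_def)
    moreover have "(\<Sum>c\<in>B. (1 / k t c) *\<^sub>R c) = (1 / t^2) *\<^sub>R z"
      unfolding zB scaleR_sum_right using disj by (intro sum.cong) (auto simp: k_def)
    moreover have "k t r = t" using rnot by (simp add: k_def)
    ultimately show ?thesis unfolding spectral_sum_def sumH by simp
  qed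
  show ?thesis
  proof
    show "u \<in> sqcone" unfolding u_def
      using idB by (intro cone_sum cone_scaleR idempotent_in_cone) (auto simp: B_def)
    show "v \<in> sqcone" unfolding v_def
      using idA by (intro cone_sum cone_scaleR idempotent_in_cone) (auto simp: A_def)
    show "r \<in> sqcone" by (rule idempotent_in_cone[OF rr])
    fix t :: real assume t: "0 < t"
    show "y + t^2 *\<^sub>R u + t *\<^sub>R r \<in> interior sqcone"
      unfolding curve[symmetric] by (intro spectral_sum_in_interior H kpos t)
    show "jinv (y + t^2 *\<^sub>R u + t *\<^sub>R r) = v + (1 / t^2) *\<^sub>R z + (1 / t) *\<^sub>R r"
      unfolding curve[symmetric] curve'[symmetric] by (intro jordan_inverse_spectral_sum H kpos t)
  qed
qed

text \<open>The normalised inverse.\<close>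

definition opposite :: "'a \<Rightarrow> 'a" where "opposite y = proj (jinv y)"

text \<open>The parameters of the normalised Hilbert distance functions.\<close>

definition opposite_pairs :: "('a \<times> 'a) set" where
  "opposite_pairs = (\<lambda>y. (y, opposite y)) ` (slice \<inter> interior sqcone)"

text \<open>The parameters of the Hilbert horofunctions.\<close>

definition complementary_pairs :: "('a \<times> 'a) set" where
  "complementary_pairs = {(y, z). y \<in> slice - interior sqcone \<and> z \<in> slice - interior sqcone \<and> y \<odot> z = 0}"

lemma opposite_in_slice: "y \<in> interior sqcone \<Longrightarrow> opposite y \<in> slice \<inter> interior sqcone"
  unfolding opposite_def by (intro cone.slice_proj_interior jordan_inverse_interior)

text \<open>For \<open>(a, b)\<close> in the set of opposite pairs, \<open>a \<odot> b = k e\<close> with \<open>k > 0\<close> and \<open>k e \<le> a\<close>. In the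
  limit \<open>k\<close> must vanish, since otherwise the limit of \<open>a\<close> would be interior.\<close>

lemma opposite_pairs_limit_frontier:
  assumes p: "(y, z) \<in> closure opposite_pairs" and new: "(y, z) \<notin> opposite_pairs"
  shows "(y, z) \<in> complementary_pairs"
proof -
  obtain q where q: "\<And>n. q n \<in> opposite_pairs" "q \<longlonglongrightarrow> (y, z)"
    using p unfolding closure_sequential by blast
  define a where "a n = fst (q n)" for n
  have a: "a n \<in> slice" "a n \<in> interior sqcone" and qa: "q n = (a n, opposite (a n))" for n
    using q(1)[of n] by (auto simp: a_def opposite_pairs_def)
  have lim_a: "a \<longlonglongrightarrow> y" and lim_b: "(\<lambda>n. opposite (a n)) \<longlonglongrightarrow> z"
    using tendsto_fst[OF q(2)] tendsto_snd[OF q(2)] by (simp_all add: qa)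
  have closed: "closed slice" by (rule compact_imp_closed[OF cone.compact_unit_slice])
  have y: "y \<in> slice" using closed_sequentially[OF closed _ lim_a] a by blast
  have z: "z \<in> slice" using closed_sequentially[OF closed _ lim_b] opposite_in_slice a by blast
  have yC: "y \<in> sqcone" and zC: "z \<in> sqcone" using y z by (auto simp: cone.unit_slice_def)
  have y_bd: "y \<notin> interior sqcone"
  proof
    assume yi: "y \<in> interior sqcone"
    have "(\<lambda>n. jinv (a n)) \<longlonglongrightarrow> jinv y"
      by (rule continuous_on_tendsto_compose[OF continuous_on_jordan_inverse lim_a yi])
        (simp add: a)
    then have "(\<lambda>n. opposite (a n)) \<longlonglongrightarrow> opposite y"
      unfolding opposite_def using jordan_inverse_interior[OF yi]
      by (intro cone.tendsto_slice_proj) (auto simp: cone.interior_in_C cone.interior_nonzero)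
    then have "z = opposite y" using lim_b LIMSEQ_unique by blast
    then show False using new y yi by (auto simp: opposite_pairs_def)
  qed
  define k where "k n = 1 / cone_M sqcone (jinv (a n)) e" for n
  have kpos: "0 < k n" for n
    using cone.cone_M_interior_pos[OF jordan_inverse_interior[OF a(2)] e_interior_cone]
    by (simp add: k_def)
  have prod: "a n \<odot> opposite (a n) = k n *\<^sub>R e" for n
    using jprod_jordan_inverse(1)[OF a(2)]
    by (simp add: opposite_def cone.slice_proj_def k_def jprod_bilin_simps)
  have below: "a n - k n *\<^sub>R e \<in> sqcone" for n
  proof -
    have "cone_M sqcone (jinv (a n)) e = cone_M sqcone e (a n)"
      using cone_M_jordan_inverse[OF e_interior_cone a(2)] by (simp add: jordan_inverse_unit)
    then have "(1 / k n) *\<^sub>R a n - e \<in> sqcone"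
      using cone.cone_M_upper[OF a(2), of e n] by (simp add: k_def)
    then have "k n *\<^sub>R ((1 / k n) *\<^sub>R a n - e) \<in> sqcone"
      using kpos[of n] by (intro cone_scaleR) auto
    then show ?thesis using kpos[of n] by (simp add: scaleR_diff_right)
  qed
  define k' where "k' = (y \<bullet> z) / (e \<bullet> e)"
  have ee: "e \<bullet> e \<noteq> 0" using e_nonzero by simp
  have lim_k: "k \<longlonglongrightarrow> k'"
  proof -
    have "k n = (a n \<bullet> opposite (a n)) / (e \<bullet> e)" for n
      using inner_jprod_e[of "a n" "opposite (a n)"] ee by (simp add: prod eq_divide_eq)
    then have "k = (\<lambda>n. (a n \<bullet> opposite (a n)) / (e \<bullet> e))" by (rule ext)
    then show ?thesis unfolding k'_def using ee by (auto intro!: tendsto_intros lim_a lim_b)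
  qed
  have "(\<lambda>n. a n - k n *\<^sub>R e) \<longlonglongrightarrow> y - k' *\<^sub>R e" by (intro tendsto_intros lim_a lim_k)
  then have low: "y - k' *\<^sub>R e \<in> sqcone" by (rule closed_sequentially[OF closed_cone below])
  have "0 \<le> k'" using cone_inner[OF yC zC] by (simp add: k'_def)
  moreover have "\<not> 0 < k'"
  proof
    assume "0 < k'"
    from cone.interior_add[OF cone.interior_scale[OF e_interior_cone this] low]
    show False using y_bd by simp
  qed
  ultimately have k0: "k' = 0" by simp
  have "(\<lambda>n. a n \<odot> opposite (a n)) \<longlonglongrightarrow> y \<odot> z"
    by (rule bounded_bilinear.tendsto[OF bounded_bilinear_jprod lim_a lim_b])
  moreover have "(\<lambda>n. a n \<odot> opposite (a n)) \<longlonglongrightarrow> k' *\<^sub>R e"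
    unfolding prod by (intro tendsto_intros lim_k)
  ultimately have yz: "y \<odot> z = 0" using LIMSEQ_unique k0 by fastforce
  have z_bd: "z \<notin> interior sqcone"
  proof
    assume "z \<in> interior sqcone"
    then obtain r where r: "0 < r" "z - r *\<^sub>R y \<in> interior sqcone" by (rule cone.interior_absorb)
    have "0 \<le> (z - r *\<^sub>R y) \<bullet> y" by (intro cone_inner cone.interior_in_C r yC)
    moreover have "z \<bullet> y = 0" using inner_jprod_e[of y z] yz by (simp add: inner_commute)
    ultimately have "r * (y \<bullet> y) \<le> 0" by (simp add: inner_diff_left)
    moreover have "0 < y \<bullet> y" using cone.unit_slice_nonzero[OF y] by simp
    ultimately show False using r(1) by (simp add: mult_le_0_iff)
  qed
  show ?thesis using y z y_bd z_bd yz by (simp add: complementary_pairs_def)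
qed

lemma complementary_pairs_in_closure:
  assumes "(y, z) \<in> complementary_pairs"
  shows "(y, z) \<in> closure opposite_pairs"
proof -
  have y: "y \<in> slice" and z: "z \<in> slice" and yz: "y \<odot> z = 0"
    using assms by (auto simp: complementary_pairs_def)
  have C: "y \<in> sqcone" "z \<in> sqcone" using y z by (auto simp: cone.unit_slice_def)
  obtain u v r where uvr: "u \<in> sqcone" "v \<in> sqcone" "r \<in> sqcone"
    "\<And>t. 0 < t \<Longrightarrow> y + t^2 *\<^sub>R u + t *\<^sub>R r \<in> interior sqcone"
    "\<And>t. 0 < t \<Longrightarrow> jinv (y + t^2 *\<^sub>R u + t *\<^sub>R r) = v + (1 / t^2) *\<^sub>R z + (1 / t) *\<^sub>R r"
    using complementary_curve[OF C yz] by blast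
  define g where "g t = y + t^2 *\<^sub>R u + t *\<^sub>R r" for t
  define h where "h t = t^2 *\<^sub>R v + z + t *\<^sub>R r" for t
  have lim_g: "((\<lambda>t. proj (g t)) \<longlongrightarrow> proj y) (at_right 0)"
    using C y cone.unit_slice_nonzero unfolding g_def
    by (intro cone.tendsto_slice_proj) (auto intro!: tendsto_eq_intros)
  have lim_h: "((\<lambda>t. proj (h t)) \<longlongrightarrow> proj z) (at_right 0)"
    using C z cone.unit_slice_nonzero unfolding h_def
    by (intro cone.tendsto_slice_proj) (auto intro!: tendsto_eq_intros)
  have lim: "((\<lambda>t. (proj (g t), proj (h t))) \<longlongrightarrow> (y, z)) (at_right 0)"
    using tendsto_Pair[OF lim_g lim_h] y z by (simp add: cone.slice_proj_id)
  have *: "(proj (g t), proj (h t)) \<in> closure opposite_pairs" if t: "0 < t" for t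
  proof -
    have g: "g t \<in> interior sqcone" using uvr(4)[OF t] by (simp add: g_def)
    have pos: "0 < 1 / cone_M sqcone (g t) e"
      using cone.cone_M_interior_pos[OF g e_interior_cone] by simp
    have "opposite (proj (g t)) = proj (jinv (g t))"
      unfolding opposite_def cone.slice_proj_def[of "g t"] jordan_inverse_scaleR[OF g pos]
      using pos by (intro cone.slice_proj_scaleR) simp
    also have "\<dots> = proj (t^2 *\<^sub>R jinv (g t))" using t by (simp add: cone.slice_proj_scaleR)
    also have "t^2 *\<^sub>R jinv (g t) = h t"
      using t uvr(5)[OF t] by (simp add: g_def h_def scaleR_add_right power2_eq_square)
    finally have "(proj (g t), proj (h t)) \<in> opposite_pairs"
      using cone.slice_proj_interior[OF g] by (auto simp: opposite_pairs_def)
    then show ?thesis using closure_subset by blast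
  qed
  have "\<forall>\<^sub>F t in at_right 0. (proj (g t), proj (h t)) \<in> closure opposite_pairs"
    using eventually_at_right_less[of "0::real"] by (rule eventually_mono) (rule *)
  from Lim_in_closed_set[OF closed_closure this _ lim] show ?thesis by simp
qed

lemma closure_opposite_pairs_new: "closure opposite_pairs - opposite_pairs = complementary_pairs"
proof (intro equalityI subrelI)
  fix y z assume "(y, z) \<in> closure opposite_pairs - opposite_pairs"
  then show "(y, z) \<in> complementary_pairs" using opposite_pairs_limit_frontier by blast
next
  fix y z assume p: "(y, z) \<in> complementary_pairs"
  then have "(y, z) \<notin> opposite_pairs" by (auto simp: complementary_pairs_def opposite_pairs_def)
  then show "(y, z) \<in> closure opposite_pairs - opposite_pairs"
    using complementary_pairs_in_closure[OF p] by blast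
qed

lemma closure_opposite_pairs_subset: "closure opposite_pairs \<subseteq> slice \<times> slice"
proof (rule closure_minimal)
  show "opposite_pairs \<subseteq> slice \<times> slice"
    using opposite_in_slice by (auto simp: opposite_pairs_def)
  show "closed (slice \<times> slice)"
    by (intro closed_Times compact_imp_closed cone.compact_unit_slice)
qed

text \<open>The function attached to a pair \<open>(y, z)\<close>; on opposite pairs it is a normalised distance
  function.\<close>

definition hilbert_horofunction :: "'a \<times> 'a \<Rightarrow> 'a \<Rightarrow> real" where
  "hilbert_horofunction p x = rfunk sqcone (jinv x) (snd p) + rfunk sqcone x (fst p)"

lemma hilbert_horofunction_bounded_below:
  assumes "p \<in> opposite_pairs"
  obtains b where "\<And>x. x \<in> interior sqcone \<Longrightarrow> b \<le> hilbert_horofunction p x"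
proof -
  obtain y where p: "p = (y, opposite y)" and y: "y \<in> slice" "y \<in> interior sqcone"
    using assms by (auto simp: opposite_pairs_def)
  have "- ln (cone_M sqcone (jinv y) e) \<le> hilbert_horofunction p x" if x: "x \<in> interior sqcone" for x
  proof -
    have pos: "0 < cone_M sqcone x y" "0 < cone_M sqcone y x"
      by (intro cone.cone_M_interior_pos x y)+
    have "1 \<le> cone_M sqcone x y * cone_M sqcone y x"
      using cone.cone_M_triangle[of x y x] x y by (simp add: cone.cone_M_self cone.interior_in_C)
    then have "0 \<le> ln (cone_M sqcone x y * cone_M sqcone y x)" by simp
    then have "0 \<le> ln (cone_M sqcone x y) + ln (cone_M sqcone y x)" using pos by (simp add: ln_mult_pos)
    then show ?thesis
      unfolding hilbert_horofunction_def p rfunk_def fst_conv snd_conv opposite_def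
      using cone.ln_cone_M_slice_proj[OF jordan_inverse_interior[OF y(2)] jordan_inverse_interior[OF x]]
        cone_M_jordan_inverse[OF x y(2)] by simp
  qed
  then show ?thesis by (rule that)
qed

text \<open>Along the curve of \<open>complementary_curve\<close> the function is at most \<open>ln (t\<^sup>2)\<close>.\<close>

lemma hilbert_horofunction_unbounded_below:
  assumes p: "p \<in> complementary_pairs"
  shows "\<exists>x\<in>interior sqcone. hilbert_horofunction p x < b"
proof -
  obtain y z where yz: "p = (y, z)" "y \<in> slice" "z \<in> slice" "y \<odot> z = 0"
    using p by (auto simp: complementary_pairs_def)
  have C: "y \<in> sqcone" "z \<in> sqcone" using yz by (auto simp: cone.unit_slice_def)
  obtain u v r where uvr: "u \<in> sqcone" "v \<in> sqcone" "r \<in> sqcone"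
    "\<And>t. 0 < t \<Longrightarrow> y + t^2 *\<^sub>R u + t *\<^sub>R r \<in> interior sqcone"
    "\<And>t. 0 < t \<Longrightarrow> jinv (y + t^2 *\<^sub>R u + t *\<^sub>R r) = v + (1 / t^2) *\<^sub>R z + (1 / t) *\<^sub>R r"
    using complementary_curve[OF C yz(4)] by blast
  \<comment> \<open>Chosen so that \<open>ln (t\<^sup>2) = b - 1\<close>.\<close>
  define t where "t = exp ((b - 1) / 2)"
  have t: "0 < t" "ln (t^2) = b - 1" by (simp_all add: t_def ln_realpow)
  define x where "x = y + t^2 *\<^sub>R u + t *\<^sub>R r"
  have x: "x \<in> interior sqcone" using uvr(4)[OF t(1)] by (simp add: x_def)
  have "x - y \<in> sqcone" unfolding x_def using uvr t(1) by (simp add: cone_add cone_scaleR)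
  then have M1: "cone_M sqcone y x \<le> 1" by (simp add: cone.cone_M_le_iff[OF x])
  have "t^2 *\<^sub>R jinv x - z = t^2 *\<^sub>R v + t *\<^sub>R r"
    unfolding x_def uvr(5)[OF t(1)] using t(1) by (simp add: scaleR_add_right power2_eq_square)
  also have "\<dots> \<in> sqcone" using uvr t(1) by (simp add: cone_add cone_scaleR)
  finally have M2: "cone_M sqcone z (jinv x) \<le> t^2"
    by (simp add: cone.cone_M_le_iff[OF jordan_inverse_interior[OF x]])
  have "0 < cone_M sqcone y x" "0 < cone_M sqcone z (jinv x)"
    using C yz cone.unit_slice_nonzero x jordan_inverse_interior by (auto intro!: cone.cone_M_pos)
  then have "ln (cone_M sqcone y x) \<le> 0" "ln (cone_M sqcone z (jinv x)) \<le> ln (t^2)"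
    using M1 M2 by (simp, subst ln_le_cancel_iff, use t in auto)
  then have "hilbert_horofunction p x < b"
    using t(2) by (simp add: hilbert_horofunction_def rfunk_def yz(1))
  then show ?thesis using x by blast
qed

lemma horofunction_boundary_hilbert:
  "horofunction_boundary sqcone e (hilbert_dist sqcone) =
    {h \<in> cont_funs (thompson_topology sqcone). \<exists>y\<in>frontier sqcone. \<exists>z\<in>frontier sqcone.
       order_unit_norm sqcone e y = 1 \<and> order_unit_norm sqcone e z = 1 \<and> y \<odot> z = 0 \<and>
       (\<forall>x\<in>interior sqcone. h x = rfunk sqcone (jinv x) z + rfunk sqcone x y)}"
proof -
  let ?C = sqcone
  have inv: "jinv x \<in> interior ?C" if "x \<in> interior ?C" for x using that by (rule jordan_inverse_interior)
  have sub: "fst p \<in> ?C" "fst p \<noteq> 0" "snd p \<in> ?C" "snd p \<noteq> 0" if "p \<in> closure opposite_pairs" for p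
    using that closure_opposite_pairs_subset cone.unit_slice_nonzero
    by (auto simp: cone.unit_slice_def)
  have compact: "compact (closure opposite_pairs)"
    using closure_opposite_pairs_subset closed_closure compact_Times[OF cone.compact_unit_slice cone.compact_unit_slice]
    by (metis closed_Int_compact inf.absorb1)
  have cont: "continuous_on (closure opposite_pairs \<times> interior ?C)
      (\<lambda>q. hilbert_horofunction (fst q) (snd q))"
    unfolding hilbert_horofunction_def rfunk_def
  proof (intro continuous_on_add continuous_on_ln cone.continuous_on_cone_M_compose ballI)
    show "continuous_on (closure opposite_pairs \<times> interior ?C) (\<lambda>q. jinv (snd q))"
      by (rule continuous_on_compose2[OF continuous_on_jordan_inverse]) (auto intro: continuous_intros)
    fix q assume q: "q \<in> closure opposite_pairs \<times> interior ?C"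
    then show "snd q \<in> interior ?C" "jinv (snd q) \<in> interior ?C" using inv by auto
    show "cone_M ?C (snd (fst q)) (jinv (snd q)) \<noteq> 0" "cone_M ?C (fst (fst q)) (snd q) \<noteq> 0"
      using q sub[of "fst q"] inv cone.cone_M_pos by (force)+
  qed (intro continuous_intros)+
  have map: "horo_map ?C e (hilbert_dist ?C) y =
      restrict (hilbert_horofunction (proj y, opposite (proj y))) (interior ?C)" if y: "y \<in> interior ?C" for y
  proof -
    have pos: "0 < 1 / cone_M sqcone y e"
      using cone.cone_M_interior_pos[OF y e_interior_cone] by simp
    have opposite: "opposite (proj y) = proj (jinv y)"
      unfolding opposite_def cone.slice_proj_def[of y] jordan_inverse_scaleR[OF y pos]
      using pos by (intro cone.slice_proj_scaleR) simp
    show ?thesis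
      unfolding horo_map_def opposite using y inv e_interior_cone
      by (intro restrict_ext)
        (simp add: hilbert_dist_def hilbert_horofunction_def funk_eq_rfunk_jordan_inverse
          jordan_inverse_unit rfunk_def cone.ln_cone_M_slice_proj)
  qed
  have img: "horo_map ?C e (hilbert_dist ?C) ` interior ?C =
      (\<lambda>p. restrict (hilbert_horofunction p) (interior ?C)) ` opposite_pairs"
  proof -
    have "y \<in> proj ` interior ?C" if "y \<in> slice \<inter> interior ?C" for y
      using that cone.slice_proj_id[of y] by (metis IntD1 IntD2 image_eqI)
    then have set: "proj ` interior ?C = slice \<inter> interior ?C"
      using cone.slice_proj_interior by blast
    have "horo_map ?C e (hilbert_dist ?C) ` interior ?C =
        (\<lambda>y. restrict (hilbert_horofunction (proj y, opposite (proj y))) (interior ?C)) ` interior ?C"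
      by (rule image_cong[OF refl map])
    also have "\<dots> = (\<lambda>p. restrict (hilbert_horofunction p) (interior ?C)) `
        (\<lambda>y. (y, opposite y)) ` proj ` interior ?C"
      by (simp only: image_image)
    finally show ?thesis unfolding set opposite_pairs_def .
  qed
  have "\<exists>x\<in>interior ?C. hilbert_horofunction p x \<noteq> hilbert_horofunction p' x"
    if p: "p \<in> closure opposite_pairs - opposite_pairs" "p' \<in> opposite_pairs" for p p'
  proof -
    obtain b where b: "\<And>x. x \<in> interior ?C \<Longrightarrow> b \<le> hilbert_horofunction p' x"
      using hilbert_horofunction_bounded_below[OF p(2)] by blast
    obtain x where x: "x \<in> interior ?C" "hilbert_horofunction p x < b"
      using hilbert_horofunction_unbounded_below p(1) unfolding closure_opposite_pairs_new by blast
    then show ?thesis using b[OF x(1)] by (intro bexI[of _ x]) auto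
  qed
  from horofunction_boundary_parametrization[where \<Phi> = hilbert_horofunction,
      OF cone.thompson_topology_eq compact refl cont img this]
  have eq: "horofunction_boundary ?C e (hilbert_dist ?C) =
     {h \<in> cont_funs (thompson_topology ?C). \<exists>p\<in>complementary_pairs.
        \<forall>x\<in>interior ?C. h x = hilbert_horofunction p x}"
    unfolding closure_opposite_pairs_new .
  show ?thesis
    unfolding eq complementary_pairs_def hilbert_horofunction_def cone.slice_frontier_iff by auto
qed

end

theorem theorem5p6:
  fixes jprod :: "'a::euclidean_space \<Rightarrow> 'a \<Rightarrow> 'a" (infixl "\<odot>" 70)
    and e :: 'a and C :: "'a set"
  assumes "euclidean_jordan_algebra (\<odot>) e"
    and "C = square_cone (\<odot>)"
  shows
    "horofunction_boundary C e (funk C) =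
       {f \<in> cont_funs (thompson_topology C).
          \<exists>z\<in>frontier C. order_unit_norm C e z = 1 \<and>
            (\<forall>x\<in>interior C. f x = rfunk C (jordan_inverse (\<odot>) e x) z)} \<and>
     horofunction_boundary C e (rfunk C) =
       {g \<in> cont_funs (thompson_topology C).
          \<exists>y\<in>frontier C. order_unit_norm C e y = 1 \<and>
            (\<forall>x\<in>interior C. g x = rfunk C x y)} \<and>
     horofunction_boundary C e (hilbert_dist C) =
       {h \<in> cont_funs (thompson_topology C).
          \<exists>y\<in>frontier C. \<exists>z\<in>frontier C.
            order_unit_norm C e y = 1 \<and> order_unit_norm C e z = 1 \<and> y \<odot> z = 0 \<and>
            (\<forall>x\<in>interior C. h x = rfunk C (jordan_inverse (\<odot>) e x) z + rfunk C x y)}"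
proof -
  interpret euclidean_jordan_algebra "(\<odot>)" e by (rule assms(1))
  show ?thesis
    unfolding assms(2)
    by (intro conjI horofunction_boundary_funk cone.horofunction_boundary_rfunk
        horofunction_boundary_hilbert)
qed

end
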